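(* Let $V$ be a Hilbert space over $\mathbb{K}=\mathbb{R}$ or $\mathbb{C}$, let $A_0$ be a densely defined skew-symmetric operator on $V$, let $A:=-A_0^*$, and let $(H_-,H_+,G_-,G_+)$ be a boundary quadruple for $A_0$. Let $B$ be an operator on $V$ which is an extension of $A_0$. The following are equivalent: (i) $B$ generates a $C_0$-semigroup of contractions on $V$; (ii) there exists a linear contraction $\Phi:H_-\to H_+$ such that $D(B)=\{w\in D(A): \Phi G_- w=G_+ w\}$ and $Bw=Aw$ for all $w\in D(B)$.
   Context: Inner products are linear in the first argument (and conjugate-linear in the second if $\mathbb{K}=\mathbb{C}$). An operator $B$ on $V$ is a linear map $B:D(B)\to V$ defined on a linear subspace $D(B)\subset V$. $B$ is an extension of $A_0$ ($A_0\subset B$) if $D(A_0)\subset D(B)$ and $Bx=A_0x$ for $x\in D(A_0)$. $A_0$ is skew-symmetric if $\langle A_0u,v\rangle_V+\langle u,A_0v\rangle_V=0$ for all $u,v\in D(A_0)$. With $A:=-A_0^*$, $D(A)=D(A_0^* )$, one has $A_0\subset A$. A boundary quadruple $(H_-,H_+,G_-,G_+)$ for $A_0$ consists of pre-Hilbert spaces $H_-,H_+$ over $\mathbb{K}$ and surjective linear maps $G_-:D(A)\to H_-$, $G_+:D(A)\to H_+$ such that $\langle Au,v\rangle_V+\langle u,Av\rangle_V=\langle G_+u,G_+v\rangle_{H_+}-\langle G_-u,G_-v\rangle_{H_-}$ for all $u,v\in D(A)$, and $\ker G_-+\ker G_+=D(A)$. A linear contraction $\Phi:H_-\to H_+$ is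 a linear map with $\|\Phi x\|_{H_+}\le\|x\|_{H_-}$ for all $x\in H_-$. *)

theory Defs
  imports "HOL-Analysis.Analysis"
begin

text \<open>
  The scalar field K is real or complex: a type of this class comes with an isometric
  isomorphism onto either the reals or all of the complex numbers, under which
  \<open>rc_conj\<close> is complex conjugation.
\<close>

class real_or_complex = real_normed_field +
  fixes to_complex :: "'a \<Rightarrow> complex"
    and rc_conj :: "'a \<Rightarrow> 'a"
  assumes to_complex_add: "to_complex (x + y) = to_complex x + to_complex y"
    and to_complex_mult: "to_complex (x * y) = to_complex x * to_complex y"
    and to_complex_scaleR: "to_complex (scaleR r x) = scaleR r (to_complex x)"
    and norm_to_complex: "norm (to_complex x) = norm x"
    and range_to_complex: "range to_complex = \<real> \<or> range to_complex = UNIV"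
    and to_complex_conj: "to_complex (rc_conj x) = cnj (to_complex x)"

instantiation real :: real_or_complex
begin
definition to_complex_real_def: "to_complex (x :: real) = complex_of_real x"
definition rc_conj_real_def: "rc_conj (x :: real) = x"
instance
  by standard (auto simp: to_complex_real_def rc_conj_real_def scaleR_conv_of_real Reals_def)
end

instantiation complex :: real_or_complex
begin
definition to_complex_complex_def: "to_complex (z :: complex) = z"
definition rc_conj_complex_def: "rc_conj (z :: complex) = cnj z"
instance
  by standard (auto simp: to_complex_complex_def rc_conj_complex_def)
end


text \<open>
  The ambient norm and topology of the type are the ones induced by the inner product
  \<open>ip\<close> (axiom \<open>ip_norm\<close>, which also gives definiteness).  A Hilbert space is a
  \<open>pre_hilbert\<close> structure on a type of class \<open>banach\<close>.
\<close>

locale pre_hilbert = vector_space smul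
  for smul :: "'k::real_or_complex \<Rightarrow> 'v::real_normed_vector \<Rightarrow> 'v" +
  fixes ip :: "'v \<Rightarrow> 'v \<Rightarrow> 'k"
  assumes scale_of_real: "smul (of_real r) x = scaleR r x"
    and ip_add_left: "ip (x + y) z = ip x z + ip y z"
    and ip_scale_left: "ip (smul a x) y = a * ip x y"
    and ip_conj_sym: "ip y x = rc_conj (ip x y)"
    and ip_norm: "ip x x = of_real ((norm x)\<^sup>2)"

lemma pre_hilbert_real_inner:
  "pre_hilbert scaleR (inner :: 'v::real_inner \<Rightarrow> 'v \<Rightarrow> real)"
  by unfold_locales
    (auto simp: algebra_simps inner_add_left inner_commute rc_conj_real_def power2_norm_eq_inner)

lemma pre_hilbert_complex:
  "pre_hilbert ((*) :: complex \<Rightarrow> complex \<Rightarrow> complex) (\<lambda>x y. x * cnj y)"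
  by unfold_locales
    (auto simp: algebra_simps scaleR_conv_of_real rc_conj_complex_def complex_norm_square
        simp del: of_real_power)


definition linear_on ::
  "('k::field \<Rightarrow> 'a::ab_group_add \<Rightarrow> 'a) \<Rightarrow> ('k \<Rightarrow> 'b::ab_group_add \<Rightarrow> 'b) \<Rightarrow> 'a set \<Rightarrow> ('a \<Rightarrow> 'b) \<Rightarrow> bool"
  where "linear_on s1 s2 D f \<longleftrightarrow>
    (\<forall>x\<in>D. \<forall>y\<in>D. f (x + y) = f x + f y) \<and> (\<forall>c. \<forall>x\<in>D. f (s1 c x) = s2 c (f x))"

text \<open>
  A partially defined map is a pair of its domain and a total function; the values of the
  function outside the domain carry no meaning, so equality of operators is never
  expressed as equality of pairs.
\<close>

type_synonym 'v partial_map = "'v set \<times> ('v \<Rightarrow> 'v)"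

abbreviation op_dom :: "'v partial_map \<Rightarrow> 'v set" where "op_dom \<equiv> fst"
abbreviation op_app :: "'v partial_map \<Rightarrow> 'v \<Rightarrow> 'v" where "op_app \<equiv> snd"

definition operator_on ::
  "('k::field \<Rightarrow> 'v::ab_group_add \<Rightarrow> 'v) \<Rightarrow> 'v partial_map \<Rightarrow> bool"
  where "operator_on smul B \<longleftrightarrow>
    module.subspace smul (op_dom B) \<and> linear_on smul smul (op_dom B) (op_app B)"

definition extends_op :: "'v partial_map \<Rightarrow> 'v partial_map \<Rightarrow> bool"
  where "extends_op B A \<longleftrightarrow>
    op_dom A \<subseteq> op_dom B \<and> (\<forall>x\<in>op_dom A. op_app B x = op_app A x)"

definition densely_defined :: "'v::topological_space partial_map \<Rightarrow> bool"
  where "densely_defined A \<longleftrightarrow> closure (op_dom A) = UNIV"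

definition skew_symmetric :: "('v \<Rightarrow> 'v \<Rightarrow> 'k::ab_group_add) \<Rightarrow> 'v partial_map \<Rightarrow> bool"
  where "skew_symmetric ip A \<longleftrightarrow>
    (\<forall>u\<in>op_dom A. \<forall>v\<in>op_dom A. ip (op_app A u) v + ip u (op_app A v) = 0)"

text \<open>For densely defined \<open>A\<close> the vector \<open>w\<close> below is unique.\<close>

definition adjoint_op :: "('v \<Rightarrow> 'v \<Rightarrow> 'k) \<Rightarrow> 'v partial_map \<Rightarrow> 'v partial_map"
  where "adjoint_op ip A =
    ({v. \<exists>w. \<forall>u\<in>op_dom A. ip (op_app A u) v = ip u w},
     \<lambda>v. THE w. \<forall>u\<in>op_dom A. ip (op_app A u) v = ip u w)"

definition neg_op :: "'v::uminus partial_map \<Rightarrow> 'v partial_map"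
  where "neg_op A = (op_dom A, \<lambda>x. - op_app A x)"


definition boundary_quadruple ::
  "('v::ab_group_add \<Rightarrow> 'v \<Rightarrow> 'k::real_or_complex) \<Rightarrow> ('k \<Rightarrow> 'v \<Rightarrow> 'v) \<Rightarrow> 'v partial_map \<Rightarrow>
   ('k \<Rightarrow> 'm::real_normed_vector \<Rightarrow> 'm) \<Rightarrow> ('m \<Rightarrow> 'm \<Rightarrow> 'k) \<Rightarrow>
   ('k \<Rightarrow> 'p::real_normed_vector \<Rightarrow> 'p) \<Rightarrow> ('p \<Rightarrow> 'p \<Rightarrow> 'k) \<Rightarrow>
   ('v \<Rightarrow> 'm) \<Rightarrow> ('v \<Rightarrow> 'p) \<Rightarrow> bool"
  where "boundary_quadruple ip smul A\<^sub>0 smul\<^sub>m ip\<^sub>m smul\<^sub>p ip\<^sub>p G\<^sub>m G\<^sub>p \<longleftrightarrow>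
    (let A = neg_op (adjoint_op ip A\<^sub>0); D = op_dom A in
      pre_hilbert smul\<^sub>m ip\<^sub>m \<and> pre_hilbert smul\<^sub>p ip\<^sub>p \<and>
      linear_on smul smul\<^sub>m D G\<^sub>m \<and> G\<^sub>m ` D = UNIV \<and>
      linear_on smul smul\<^sub>p D G\<^sub>p \<and> G\<^sub>p ` D = UNIV \<and>
      (\<forall>u\<in>D. \<forall>v\<in>D. ip (op_app A u) v + ip u (op_app A v)
         = ip\<^sub>p (G\<^sub>p u) (G\<^sub>p v) - ip\<^sub>m (G\<^sub>m u) (G\<^sub>m v)) \<and>
      {x + y | x y. x \<in> D \<and> G\<^sub>m x = 0 \<and> y \<in> D \<and> G\<^sub>p y = 0} = D)"

definition linear_contraction ::
  "('k::field \<Rightarrow> 'm::real_normed_vector \<Rightarrow> 'm) \<Rightarrow> ('k \<Rightarrow> 'p::real_normed_vector \<Rightarrow> 'p) \<Rightarrow>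
   ('m \<Rightarrow> 'p) \<Rightarrow> bool"
  where "linear_contraction smul\<^sub>m smul\<^sub>p \<Phi> \<longleftrightarrow>
    Vector_Spaces.linear smul\<^sub>m smul\<^sub>p \<Phi> \<and> (\<forall>x. norm (\<Phi> x) \<le> norm x)"


text \<open>Only the values \<open>T t\<close> with \<open>t \<ge> 0\<close> matter.\<close>

definition C0_semigroup ::
  "('k::field \<Rightarrow> 'v::real_normed_vector \<Rightarrow> 'v) \<Rightarrow> (real \<Rightarrow> 'v \<Rightarrow> 'v) \<Rightarrow> bool"
  where "C0_semigroup smul T \<longleftrightarrow>
    (\<forall>t\<ge>0. Vector_Spaces.linear smul smul (T t) \<and> bounded_linear (T t)) \<and>
    (\<forall>x. T 0 x = x) \<and>
    (\<forall>s\<ge>0. \<forall>t\<ge>0. \<forall>x. T (s + t) x = T s (T t x)) \<and>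
    (\<forall>x. ((\<lambda>t. T t x) \<longlongrightarrow> x) (at_right 0))"

definition generator_of :: "'v::real_normed_vector partial_map \<Rightarrow> (real \<Rightarrow> 'v \<Rightarrow> 'v) \<Rightarrow> bool"
  where "generator_of B T \<longleftrightarrow>
    op_dom B = {x. \<exists>y. ((\<lambda>t. (1 / t) *\<^sub>R (T t x - x)) \<longlongrightarrow> y) (at_right 0)} \<and>
    (\<forall>x\<in>op_dom B. ((\<lambda>t. (1 / t) *\<^sub>R (T t x - x)) \<longlongrightarrow> op_app B x) (at_right 0))"

definition generates_contraction_semigroup ::
  "('k::field \<Rightarrow> 'v::real_normed_vector \<Rightarrow> 'v) \<Rightarrow> 'v partial_map \<Rightarrow> bool"
  where "generates_contraction_semigroup smul B \<longleftrightarrow>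
    (\<exists>T. C0_semigroup smul T \<and> (\<forall>t\<ge>0. \<forall>x. norm (T t x) \<le> norm x) \<and> generator_of B T)"

end

theory Submission
  imports Defs
begin

text \<open>
  Everything is done with the real form \<open>Re \<langle>x, y\<rangle>\<close>; linearity over \<open>K\<close> is recovered at the end.
  The trace spaces turn out to be complete: solving \<open>A z = z\<close>, \<open>G\<^sub>p z = y\<close> embeds \<open>H\<^sub>+\<close> contractively
  into \<open>V\<close>, Green's identity makes \<open>G\<^sub>p\<close> weakly continuous, and replacing \<open>A\<close> by \<open>- A\<close> exchanges
  \<open>H\<^sub>+\<close> and \<open>H\<^sub>-\<close>. Hence every contraction \<open>\<Phi>\<close> has an adjoint, which makes the restriction of \<open>A\<close> to
  \<open>{w. \<Phi> (G\<^sub>m w) = G\<^sub>p w}\<close> closed and maximal dissipative; its semigroup is the limit of the implicit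
  Euler scheme with dyadic steps. Conversely, the generator \<open>B\<close> of a contraction semigroup is
  dissipative with \<open>1 - B\<close> onto, a dissipative extension of \<open>A\<^sub>0\<close> is a restriction of \<open>A\<close> on which
  \<open>\<parallel>G\<^sub>p w\<parallel> \<le> \<parallel>G\<^sub>m w\<parallel>\<close>, and maximality forces \<open>G\<^sub>m\<close> to map its domain onto \<open>H\<^sub>-\<close>.
\<close>

section \<open>Inner products\<close>

text \<open>The obstacle is a threatening circle. The trace spaces are only assumed to be
  pre-Hilbert, but the adjoint of a contraction \<Phi> comes from the Riesz representation and needs
  completeness, while completeness is deduced from solving \<open>A z = z\<close> with a prescribed
  trace, which is itself a range statement for a restriction of \<open>A\<close>. The circle is
  broken by \<Phi> = 0: its adjoint is 0, so the range statement is first proved for a \<Phi> that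
  comes with an adjoint, then used for \<Phi> = 0 to get completeness, and only then extended to
  every contraction. The condition on the two kernels says more than surjectivity of each trace: the
  pair of traces is jointly onto, so both boundary values can be prescribed independently. Nearly
  every test vector is obtained in this way. Steps of the Euler scheme are halved because two steps
  of length \<open>k\<close> and one of length \<open>2 * k\<close> can be compared through the
  resolvent alone; on the dense set where \<open>B (B x)\<close> makes sense the resulting errors
  form a geometric series.\<close>

locale inner_form =
  fixes r :: "'a::real_normed_vector \<Rightarrow> 'a \<Rightarrow> real"
  assumes add_left: "r (x + y) z = r x z + r y z"
    and scaleR_left: "r (c *\<^sub>R x) z = c * r x z"
    and sym: "r x y = r y x"
    and norm_sq: "r x x = (norm x)\<^sup>2"
begin

lemma add_right: "r x (y + z) = r x y + r x z"
  by (metis add_left sym)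

lemma scaleR_right: "r x (c *\<^sub>R y) = c * r x y"
  by (metis scaleR_left sym)

lemma norm_add_sq: "(norm (x + y))\<^sup>2 = (norm x)\<^sup>2 + 2 * r x y + (norm y)\<^sup>2"
  using sym[of x y] by (simp add: norm_sq[symmetric] add_left add_right)

lemma upper_bound: "r x y \<le> norm x * norm y"
proof -
  have "(norm (x + y))\<^sup>2 \<le> (norm x + norm y)\<^sup>2"
    by (intro power_mono norm_triangle_ineq) auto
  then show ?thesis
    unfolding norm_add_sq by (simp add: power2_sum)
qed

lemma cauchy_schwarz: "\<bar>r x y\<bar> \<le> norm x * norm y"
  using upper_bound[of x y] upper_bound[of "- x" y] scaleR_left[of "- 1" x y] by simp

sublocale bounded_bilinear r
  by unfold_locales
    (auto simp: add_left add_right scaleR_left scaleR_right cauchy_schwarz intro!: exI[of _ 1])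

lemma norm_diff_sq: "(norm (x - y))\<^sup>2 = (norm x)\<^sup>2 - 2 * r x y + (norm y)\<^sup>2"
  using norm_add_sq[of x "- y"] by (simp add: minus_right)

lemma parallelogram:
  fixes x y :: 'a
  shows "(norm (x - y))\<^sup>2 + (norm (x + y))\<^sup>2 = 2 * (norm x)\<^sup>2 + 2 * (norm y)\<^sup>2"
  by (simp add: norm_add_sq norm_diff_sq)

text \<open>By the parallelogram law a minimizing sequence is Cauchy, and at its limit the first
  variation of the squared distance vanishes.\<close>

lemma orthogonal_projection:
  assumes S: "subspace S" "complete S"
  shows "\<exists>p\<in>S. \<forall>s\<in>S. r (x - p) s = 0"
proof -
  define f where "f s = (norm (x - s))\<^sup>2" for s
  define d where "d = (INF s\<in>S. f s)"
  have S0: "0 \<in> S" using S(1) by (rule subspace_0)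
  have bdd: "bdd_below (f ` S)"
    by (rule bdd_belowI[of _ 0]) (auto simp: f_def)
  have d_le: "d \<le> f s" if "s \<in> S" for s
    unfolding d_def using bdd that by (rule cINF_lower)
  have ex: "\<exists>s\<in>S. f s < d + e" if "e > 0" for e
    using cINF_less_iff[OF _ bdd, of "d + e"] S0 that unfolding d_def by fastforce
  have "\<forall>n. \<exists>s\<in>S. f s < d + inverse (real (Suc n))"
    using ex by simp
  then obtain p where p: "\<And>n. p n \<in> S" "\<And>n. f (p n) < d + inverse (real (Suc n))"
    by metis
  \<comment> \<open>The midpoint of \<open>a\<close> and \<open>b\<close> lies in \<open>S\<close>,
    so its squared distance to \<open>x\<close> is at least \<open>d\<close>.\<close>
  have gap: "(norm (a - b))\<^sup>2 \<le> 2 * f a + 2 * f b - 4 * d" if "a \<in> S" "b \<in> S" for a b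
  proof -
    let ?c = "(1/2) *\<^sub>R (a + b)"
    have c: "?c \<in> S" using that S(1) by (simp add: subspace_add subspace_scale)
    have "norm ((x - a) + (x - b)) = norm (2 *\<^sub>R (x - ?c))"
      by (rule arg_cong[of _ _ norm]) (simp add: scaleR_diff_right scaleR_2)
    then have "(norm ((x - a) + (x - b)))\<^sup>2 = 4 * f ?c"
      by (simp add: f_def power_mult_distrib)
    moreover have "(norm ((x - a) - (x - b)))\<^sup>2 = (norm (a - b))\<^sup>2"
      by (simp add: norm_minus_commute)
    ultimately show ?thesis
      using parallelogram[of "x - a" "x - b"] d_le[OF c] by (simp add: f_def)
  qed
  have "Cauchy p"
  proof (rule metric_CauchyI)
    fix e :: real assume "e > 0"
    then obtain N where N: "inverse (real (Suc N)) < e\<^sup>2 / 4"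
      using reals_Archimedean[of "e\<^sup>2 / 4"] by auto
    show "\<exists>M. \<forall>m\<ge>M. \<forall>n\<ge>M. dist (p m) (p n) < e"
    proof (intro exI[of _ N] allI impI)
      fix m n assume mn: "N \<le> m" "N \<le> n"
      have "inverse (real (Suc m)) \<le> inverse (real (Suc N))"
        "inverse (real (Suc n)) \<le> inverse (real (Suc N))"
        using mn by (auto intro!: le_imp_inverse_le)
      then have "(norm (p m - p n))\<^sup>2 < e\<^sup>2"
        using gap[OF p(1) p(1), of m n] p(2)[of m] p(2)[of n] N by linarith
      then show "dist (p m) (p n) < e"
        using \<open>e > 0\<close> by (simp add: dist_norm power2_less_imp_less)
    qed
  qed
  then obtain q where q: "q \<in> S" "p \<longlonglongrightarrow> q"
    using S(2) p(1) unfolding complete_def by blast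
  have "f q \<le> d"
  proof (rule LIMSEQ_le)
    show "(\<lambda>n. f (p n)) \<longlonglongrightarrow> f q"
      unfolding f_def by (intro tendsto_intros q)
    show "(\<lambda>n. d + inverse (real (Suc n))) \<longlonglongrightarrow> d"
      using LIMSEQ_inverse_real_of_nat_add .
  qed (use p(2) less_imp_le in blast)
  show ?thesis
  proof (intro bexI[OF _ q(1)] ballI)
    fix s assume s: "s \<in> S"
    let ?a = "r (x - q) s"
    have "2 * t * ?a \<le> t\<^sup>2 * (norm s)\<^sup>2" for t
    proof -
      have "q + t *\<^sub>R s \<in> S"
        using s q(1) S(1) by (simp add: subspace_add subspace_scale)
      then have "f q \<le> f (q + t *\<^sub>R s)"
        using d_le \<open>f q \<le> d\<close> by force
      also have "f (q + t *\<^sub>R s) = f q - 2 * (t * ?a) + t\<^sup>2 * (norm s)\<^sup>2"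
        using norm_diff_sq[of "x - q" "t *\<^sub>R s"]
        by (simp add: f_def diff_diff_eq scaleR_right power_mult_distrib)
      finally show ?thesis by simp
    qed
    \<comment> \<open>The sharpest \<open>t\<close> would be \<open>?a / (norm s)\<^sup>2\<close>;
      the added 1 keeps the denominator positive when \<open>s = 0\<close>.\<close>
    from this[of "?a / ((norm s)\<^sup>2 + 1)"]
    have "2 * ?a\<^sup>2 / ((norm s)\<^sup>2 + 1) \<le> ?a\<^sup>2 * (norm s)\<^sup>2 / ((norm s)\<^sup>2 + 1)\<^sup>2"
      by (simp add: power_divide power2_eq_square)
    moreover have "(norm s)\<^sup>2 + 1 > 0" by (simp add: add_nonneg_pos)
    ultimately have "2 * ?a\<^sup>2 * ((norm s)\<^sup>2 + 1) \<le> ?a\<^sup>2 * (norm s)\<^sup>2"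
      by (simp add: divide_simps power2_eq_square mult_ac)
    then have "?a\<^sup>2 * (norm s)\<^sup>2 + 2 * ?a\<^sup>2 \<le> 0" by (simp add: algebra_simps)
    moreover have "?a\<^sup>2 * (norm s)\<^sup>2 \<ge> 0" by simp
    ultimately have "?a\<^sup>2 \<le> 0" by linarith
    then show "?a = 0" by simp
  qed
qed

lemma complete_subspace_eq_UNIV:
  assumes "subspace S" "complete S" and orth: "\<And>v. (\<And>s. s \<in> S \<Longrightarrow> r s v = 0) \<Longrightarrow> v = 0"
  shows "S = UNIV"
proof -
  have "x \<in> S" for x
  proof -
    obtain p where p: "p \<in> S" "\<forall>s\<in>S. r (x - p) s = 0"
      using orthogonal_projection[OF assms(1,2)] by blast
    have "x - p = 0" by (rule orth) (use p(2) sym in metis)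
    with p(1) show ?thesis by simp
  qed
  then show ?thesis by auto
qed

text \<open>The kernel of \<open>f\<close> is closed, hence complete. The representing vector is the
  multiple of a vector \<open>q\<close> orthogonal to it that gives the right value at
  \<open>q\<close>; every \<open>z\<close> is brought into the kernel by subtracting
  \<open>(f z / f q) *\<^sub>R q\<close>.\<close>

lemma riesz_representation:
  assumes complete: "complete (UNIV :: 'a set)" and f: "bounded_linear f"
  shows "\<exists>y. \<forall>x. f x = r x y"
proof (cases "\<forall>x. f x = 0")
  case True
  then show ?thesis by (auto intro!: exI[of _ 0] simp: zero_right)
next
  case False
  then obtain x where x: "f x \<noteq> 0" by blast
  interpret f: bounded_linear f by fact
  let ?K = "{z. f z = 0}"
  have "closed ?K"
    by (intro closed_Collect_eq continuous_intros f.continuous_on)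
  then have "complete ?K"
    using complete_closed_subset[OF _ subset_UNIV complete] by blast
  moreover have "subspace ?K"
    by (auto simp: subspace_def f.zero f.add f.scaleR)
  ultimately obtain p where p: "f p = 0" "\<And>s. f s = 0 \<Longrightarrow> r (x - p) s = 0"
    using orthogonal_projection[of ?K x] by auto
  define q where "q = x - p"
  have fq: "f q \<noteq> 0" using x p(1) by (simp add: q_def f.diff)
  then have "q \<noteq> 0" by (auto simp: f.zero)
  have "f z = r z ((f q / (norm q)\<^sup>2) *\<^sub>R q)" for z
  proof -
    have "f (z - (f z / f q) *\<^sub>R q) = 0"
      using fq by (simp add: f.diff f.scaleR)
    then have "r q (z - (f z / f q) *\<^sub>R q) = 0"
      using p(2) unfolding q_def by blast
    then have "r z q = f z / f q * (norm q)\<^sup>2"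
      by (simp add: diff_right scaleR_right norm_sq sym)
    then show ?thesis
      using fq \<open>q \<noteq> 0\<close> by (simp add: scaleR_right field_simps)
  qed
  then show ?thesis by blast
qed

text \<open>Pairing \<open>u - h *\<^sub>R b\<close> with \<open>u\<close> gives at least
  \<open>(norm u)\<^sup>2\<close>. This makes 1 - h B expansive, the source of injectivity, closed
  range and contractive resolvents.\<close>

lemma dissipative_norm_le:
  assumes "r b u \<le> 0" "h \<ge> 0"
  shows "norm u \<le> norm (u - h *\<^sub>R b)"
proof (cases "u = 0")
  case False
  have "(norm u)\<^sup>2 \<le> r (u - h *\<^sub>R b) u"
    using assms by (simp add: diff_left scaleR_left norm_sq mult_nonneg_nonpos)
  also have "\<dots> \<le> norm (u - h *\<^sub>R b) * norm u" by (rule upper_bound)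
  finally show ?thesis using False by (simp add: power2_eq_square)
qed simp

end

section \<open>Maximal dissipative restrictions\<close>

lemma linear_on_diff:
  fixes f :: "'a::real_vector \<Rightarrow> 'b::real_vector"
  assumes "linear_on scaleR scaleR D f" "subspace D" "x \<in> D" "y \<in> D"
  shows "f (x - y) = f x - f y"
proof -
  have "- 1 *\<^sub>R y \<in> D" using assms subspace_scale by blast
  then have "f (x + - 1 *\<^sub>R y) = f x + - 1 *\<^sub>R f y"
    using assms unfolding linear_on_def by metis
  then show ?thesis by simp
qed

lemma linear_on_image_subspace:
  fixes f :: "'a::real_vector \<Rightarrow> 'b::real_vector"
  assumes "linear_on scaleR scaleR D f" "subspace D"
  shows "subspace (f ` D)"
proof (rule subspaceI)
  have "f 0 = 0" using linear_on_diff[OF assms, of 0 0] assms(2) by (simp add: subspace_0)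
  then show "0 \<in> f ` D" using assms(2) subspace_0 by force
next
  fix x y assume "x \<in> f ` D" "y \<in> f ` D"
  then show "x + y \<in> f ` D"
    using assms by (auto simp: linear_on_def) (metis image_eqI subspace_add)
next
  fix c x assume "x \<in> f ` D"
  then show "c *\<^sub>R x \<in> f ` D"
    using assms by (auto simp: linear_on_def) (metis image_eqI subspace_scale)
qed

lemma subspace_closure:
  fixes S :: "'a::real_normed_vector set"
  assumes S: "subspace S"
  shows "subspace (closure S)"
proof (rule subspaceI)
  show "0 \<in> closure S" using S closure_subset subspace_0 by blast
next
  fix x y assume "x \<in> closure S" "y \<in> closure S"
  then obtain a b where a: "\<forall>n. a n \<in> S" "a \<longlonglongrightarrow> x" and b: "\<forall>n. b n \<in> S" "b \<longlonglongrightarrow> y"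
    unfolding closure_sequential by blast
  then have "\<forall>n. a n + b n \<in> S" "(\<lambda>n. a n + b n) \<longlonglongrightarrow> x + y"
    using S by (auto simp: subspace_add intro: tendsto_add)
  then show "x + y \<in> closure S"
    unfolding closure_sequential by (intro exI[of _ "\<lambda>n. a n + b n"] conjI)
next
  fix c x assume "x \<in> closure S"
  then obtain a where a: "\<forall>n. a n \<in> S" "a \<longlonglongrightarrow> x"
    unfolding closure_sequential by blast
  then have "\<forall>n. c *\<^sub>R a n \<in> S" "(\<lambda>n. c *\<^sub>R a n) \<longlonglongrightarrow> c *\<^sub>R x"
    using S by (auto simp: subspace_scale intro: tendsto_scaleR)
  then show "c *\<^sub>R x \<in> closure S"
    unfolding closure_sequential by (intro exI[of _ "\<lambda>n. c *\<^sub>R a n"] conjI)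
qed

text \<open>Pulls a Cauchy sequence of images back through an expansive correspondence, or pushes
  one forward through a nonexpansive one, without naming a map.\<close>

lemma Cauchy_dominated:
  fixes s :: "nat \<Rightarrow> 'a::metric_space" and u :: "nat \<Rightarrow> 'b::metric_space"
  assumes "Cauchy s" and le: "\<And>m n. dist (u m) (u n) \<le> dist (s m) (s n)"
  shows "Cauchy u"
proof (rule metric_CauchyI)
  fix e :: real assume "e > 0"
  then obtain N where N: "\<forall>m\<ge>N. \<forall>n\<ge>N. dist (s m) (s n) < e"
    using assms(1) unfolding Cauchy_def by blast
  have "\<forall>m\<ge>N. \<forall>n\<ge>N. dist (u m) (u n) < e"
    using N le le_less_trans by blast
  then show "\<exists>M. \<forall>m\<ge>M. \<forall>n\<ge>M. dist (u m) (u n) < e" by blast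
qed

text \<open>The assumption \<open>adjoint\<close> encodes that \<open>(D, A)\<close> is minus the
  adjoint of \<open>A\<close> restricted to \<open>D0\<close>: a single family of equations decides
  both membership in \<open>D\<close> and the value of \<open>A\<close>. The assumption
  \<open>traces_onto\<close> is the form in which the kernel condition is used.\<close>

locale boundary_form =
  V: inner_form r + M: inner_form rm + P: inner_form rp
  for r :: "'v::banach \<Rightarrow> 'v \<Rightarrow> real"
    and rm :: "'m::real_normed_vector \<Rightarrow> 'm \<Rightarrow> real"
    and rp :: "'p::real_normed_vector \<Rightarrow> 'p \<Rightarrow> real" +
  fixes D0 D :: "'v set" and A :: "'v \<Rightarrow> 'v" and Gm :: "'v \<Rightarrow> 'm" and Gp :: "'v \<Rightarrow> 'p"
  assumes D: "subspace D" and D0_subset: "D0 \<subseteq> D"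
    and A_linear: "linear_on scaleR scaleR D A"
    and Gm_linear: "linear_on scaleR scaleR D Gm"
    and Gp_linear: "linear_on scaleR scaleR D Gp"
    and adjoint: "(\<forall>u\<in>D0. r (A u) v + r u w = 0) \<longleftrightarrow> v \<in> D \<and> A v = w"
    and green: "u \<in> D \<Longrightarrow> v \<in> D \<Longrightarrow>
      r (A u) v + r u (A v) = rp (Gp u) (Gp v) - rm (Gm u) (Gm v)"
    and traces_onto: "\<exists>w\<in>D. Gm w = x \<and> Gp w = y"
begin

lemmas A_diff = linear_on_diff[OF A_linear D]
  and Gm_diff = linear_on_diff[OF Gm_linear D]
  and Gp_diff = linear_on_diff[OF Gp_linear D]

lemma green_self: "u \<in> D \<Longrightarrow> 2 * r (A u) u = (norm (Gp u))\<^sup>2 - (norm (Gm u))\<^sup>2"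
  using green[of u u] by (simp add: V.sym[of u] P.norm_sq M.norm_sq)

text \<open>Both sides of Green's identity change sign with \<open>A\<close>, which puts
  \<open>rm\<close> in the place of \<open>rp\<close>; the defining equations of the adjoint are
  also preserved.\<close>

lemma swapped: "boundary_form r rp rm D0 D (\<lambda>u. - A u) Gp Gm"
proof unfold_locales
  show "linear_on scaleR scaleR D (\<lambda>u. - A u)"
    using A_linear by (auto simp: linear_on_def)
  fix v w
  have "(\<forall>u\<in>D0. r (- A u) v + r u w = 0) \<longleftrightarrow> (\<forall>u\<in>D0. r (A u) v + r u (- w) = 0)"
    by (auto simp: V.minus_left V.minus_right)
  then show "(\<forall>u\<in>D0. r (- A u) v + r u w = 0) \<longleftrightarrow> v \<in> D \<and> - A v = w"
    unfolding adjoint by auto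
next
  fix u v assume "u \<in> D" "v \<in> D"
  then show "r (- A u) v + r u (- A v) = rm (Gm u) (Gm v) - rp (Gp u) (Gp v)"
    using green[of u v] by (simp add: V.minus_left V.minus_right)
next
  fix x y show "\<exists>w\<in>D. Gp w = x \<and> Gm w = y" using traces_onto[of y x] by blast
qed (use D D0_subset Gm_linear Gp_linear in auto)

text \<open>The equations in \<open>adjoint\<close> are continuous in the pair
  \<open>(v, w)\<close>, so they pass to the limit.\<close>

lemma closed_operator:
  assumes u: "\<And>n. u n \<in> D" "u \<longlonglongrightarrow> x" and Au: "(\<lambda>n. A (u n)) \<longlonglongrightarrow> y"
  shows "x \<in> D \<and> A x = y"
proof -
  have "r (A v) x + r v y = 0" if "v \<in> D0" for v
  proof (rule LIMSEQ_unique)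
    show "(\<lambda>n. r (A v) (u n) + r v (A (u n))) \<longlonglongrightarrow> r (A v) x + r v y"
      by (intro tendsto_intros V.tendsto u Au)
    show "(\<lambda>n. r (A v) (u n) + r v (A (u n))) \<longlonglongrightarrow> 0"
    proof -
      have "r (A v) (u n) + r v (A (u n)) = 0" for n
        using adjoint[of "u n" "A (u n)"] u(1) that by blast
      then show ?thesis by simp
    qed
  qed
  then show ?thesis using adjoint by blast
qed

text \<open>With one argument in \<open>D0\<close> the left side of Green's identity vanishes.
  Testing against vectors with traces \<open>(Gm v, 0)\<close> and \<open>(0, Gp v)\<close> isolates
  the two norms. Hence \<open>D0\<close> satisfies every linear boundary condition.\<close>

lemma D0_traces:
  assumes "v \<in> D0"
  shows "Gm v = 0" "Gp v = 0"
proof -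
  have v: "v \<in> D" using assms D0_subset by blast
  have eq: "rp (Gp u) (Gp v) = rm (Gm u) (Gm v)" if u: "u \<in> D" for u
  proof -
    have "r (A v) u + r v (A u) = 0" using adjoint[of u "A u"] u assms by blast
    then show ?thesis using green[OF u v] by (simp add: V.sym add.commute)
  qed
  obtain w where w: "w \<in> D" "Gm w = Gm v" "Gp w = 0" using traces_onto by blast
  show "Gm v = 0" using eq[OF w(1)] w by (simp add: M.norm_sq P.zero_left)
  obtain w where w: "w \<in> D" "Gm w = 0" "Gp w = Gp v" using traces_onto by blast
  show "Gp v = 0" using eq[OF w(1)] w by (simp add: P.norm_sq M.zero_left)
qed

section \<open>Restrictions of \<open>A\<close> by a boundary condition\<close>

definition graph_dom :: "('m \<Rightarrow> 'p) \<Rightarrow> 'v set"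
  where "graph_dom \<Phi> = {w \<in> D. \<Phi> (Gm w) = Gp w}"

lemma subspace_graph_dom:
  assumes "linear \<Phi>"
  shows "subspace (graph_dom \<Phi>)"
proof (rule subspaceI)
  have "0 \<in> D" using D by (rule subspace_0)
  moreover from this have "Gm 0 = 0" "Gp 0 = 0"
    using Gm_diff[of 0 0] Gp_diff[of 0 0] by auto
  ultimately show "0 \<in> graph_dom \<Phi>"
    using linear_0[OF assms] by (simp add: graph_dom_def)
qed (use D Gm_linear Gp_linear in \<open>auto simp: graph_dom_def linear_on_def linear_add[OF assms]
       linear_scale[OF assms] subspace_add subspace_scale\<close>)

lemma graph_dom_dissipative:
  assumes "\<And>x. norm (\<Phi> x) \<le> norm x" "u \<in> graph_dom \<Phi>"
  shows "r (A u) u \<le> 0"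
proof -
  have "(norm (Gp u))\<^sup>2 \<le> (norm (Gm u))\<^sup>2"
    using assms by (auto simp: graph_dom_def intro!: power_mono dest: sym)
  moreover have "u \<in> D" using assms by (simp add: graph_dom_def)
  ultimately show ?thesis using green_self[of u] by linarith
qed

text \<open>The boundary condition is carried to the limit without continuity of the traces: for
  \<open>v\<close> with traces \<open>(\<Psi> e, e)\<close>, Green's identity expresses the pairing
  of the defect \<open>Gp w - \<Phi> (Gm w)\<close> with \<open>e\<close> through \<open>w\<close>
  and \<open>A w\<close> only. Taking \<open>e\<close> to be the defect of \<open>x\<close> makes
  that pairing its squared norm.\<close>

lemma graph_dom_closed:
  assumes adj: "\<And>x y. rp (\<Phi> x) y = rm x (\<Psi> y)"
    and u: "\<And>n. u n \<in> graph_dom \<Phi>" "u \<longlonglongrightarrow> x" and Au: "(\<lambda>n. A (u n)) \<longlonglongrightarrow> y"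
  shows "x \<in> graph_dom \<Phi> \<and> A x = y"
proof -
  have uD: "u n \<in> D" for n using u(1) by (simp add: graph_dom_def)
  have x: "x \<in> D" "A x = y" using closed_operator[OF uD u(2) Au] by auto
  define e where "e = Gp x - \<Phi> (Gm x)"
  obtain v where v: "v \<in> D" "Gm v = \<Psi> e" "Gp v = e" using traces_onto by blast
  have form: "r (A w) v + r w (A v) = rp (Gp w - \<Phi> (Gm w)) e" if "w \<in> D" for w
    using green[OF that v(1)] v by (simp add: P.diff_left adj)
  have "r (A x) v + r x (A v) = 0"
  proof (rule LIMSEQ_unique)
    show "(\<lambda>n. r (A (u n)) v + r (u n) (A v)) \<longlonglongrightarrow> r (A x) v + r x (A v)"
      unfolding x(2) by (intro tendsto_intros V.tendsto u Au)
    show "(\<lambda>n. r (A (u n)) v + r (u n) (A v)) \<longlonglongrightarrow> 0"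
      using form[OF uD] u(1) by (simp add: graph_dom_def P.zero_left)
  qed
  then have "e = 0" using form[OF x(1)] by (simp add: e_def P.norm_sq)
  then show ?thesis using x by (simp add: graph_dom_def e_def)
qed

text \<open>The range is closed because the restricted operator is closed and dissipative. A vector
  \<open>v\<close> orthogonal to it satisfies \<open>h A v = - v\<close> and \<open>\<parallel>G\<^sub>m v\<parallel> \<le> \<parallel>G\<^sub>p v\<parallel>\<close>, so Green's identity
  forces \<open>v = 0\<close>.\<close>

lemma graph_dom_range_of_adjoint:
  assumes \<Phi>: "linear \<Phi>" "\<And>x. norm (\<Phi> x) \<le> norm x"
    and adj: "\<And>x y. rp (\<Phi> x) y = rm x (\<Psi> y)" and h: "h > 0"
  shows "\<exists>u\<in>graph_dom \<Phi>. u - h *\<^sub>R A u = f"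
proof -
  let ?R = "\<lambda>u. u - h *\<^sub>R A u"
  let ?S = "?R ` graph_dom \<Phi>"
  have dom: "subspace (graph_dom \<Phi>)" using \<Phi>(1) by (rule subspace_graph_dom)
  have sub: "graph_dom \<Phi> \<subseteq> D" by (auto simp: graph_dom_def)
  have R_lin: "linear_on scaleR scaleR (graph_dom \<Phi>) ?R"
    using A_linear sub by (auto simp: linear_on_def algebra_simps subset_iff)
  have S: "subspace ?S" using R_lin dom by (rule linear_on_image_subspace)
  have expand: "norm (u - v) \<le> norm (?R u - ?R v)"
    if "u \<in> graph_dom \<Phi>" "v \<in> graph_dom \<Phi>" for u v
  proof -
    have "u - v \<in> graph_dom \<Phi>" using that dom by (simp add: subspace_diff)
    then have "norm (u - v) \<le> norm (?R (u - v))"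
      using V.dissipative_norm_le[OF graph_dom_dissipative[OF \<Phi>(2)]] h by simp
    then show ?thesis using linear_on_diff[OF R_lin dom that] by simp
  qed
  have "complete ?S"
  proof (rule completeI)
    fix s assume s: "\<forall>n. s n \<in> ?S" "Cauchy s"
    then have "\<forall>n. \<exists>u. u \<in> graph_dom \<Phi> \<and> s n = ?R u" by auto
    then obtain u where "\<forall>n. u n \<in> graph_dom \<Phi> \<and> s n = ?R (u n)"
      by (rule choice[THEN exE])
    then have u: "\<And>n. u n \<in> graph_dom \<Phi>" "\<And>n. s n = ?R (u n)" by auto
    have "Cauchy u"
      using s(2) by (rule Cauchy_dominated) (simp add: dist_norm u(2) expand[OF u(1) u(1)])
    then obtain x where x: "u \<longlonglongrightarrow> x" by (auto dest: Cauchy_convergent convergentD)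
    obtain y where y: "s \<longlonglongrightarrow> y" using s(2) by (auto dest: Cauchy_convergent convergentD)
    have "(\<lambda>n. (1 / h) *\<^sub>R (u n - s n)) \<longlonglongrightarrow> (1 / h) *\<^sub>R (x - y)"
      by (intro tendsto_intros x y)
    then have "(\<lambda>n. A (u n)) \<longlonglongrightarrow> (1 / h) *\<^sub>R (x - y)" using h by (simp add: u(2))
    then have "x \<in> graph_dom \<Phi>" "A x = (1 / h) *\<^sub>R (x - y)"
      using graph_dom_closed[OF adj u(1) x] by auto
    then have "y \<in> ?S" using h by (auto intro!: image_eqI[of _ _ x])
    with y show "\<exists>l\<in>?S. s \<longlonglongrightarrow> l" by blast
  qed
  moreover have "v = 0" if orth: "\<And>s. s \<in> ?S \<Longrightarrow> r s v = 0" for v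
  proof -
    have eq: "r (A u) v + r u (- (1 / h) *\<^sub>R v) = 0" if "u \<in> graph_dom \<Phi>" for u
    proof -
      have "r u v = h * r (A u) v"
        using orth[of "?R u"] that by (simp add: V.diff_left V.scaleR_left)
      then show ?thesis using h by (simp add: V.scaleR_right V.minus_right)
    qed
    \<comment> \<open>Orthogonality is tested on the whole restricted domain, which contains
      \<open>D0\<close>; this is what places \<open>v\<close> in \<open>D\<close>.\<close>
    have "D0 \<subseteq> graph_dom \<Phi>"
      using D0_subset linear_0[OF \<Phi>(1)] by (auto simp: graph_dom_def D0_traces)
    then have "\<forall>u\<in>D0. r (A u) v + r u (- (1 / h) *\<^sub>R v) = 0" using eq by auto
    then have v: "v \<in> D" "A v = - (1 / h) *\<^sub>R v"
      by (simp_all only: adjoint)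
    \<comment> \<open>This \<open>u\<close> satisfies the boundary condition and shares the minus
      trace of \<open>v\<close>, so Green's identity for \<open>u\<close> and \<open>v\<close>
      compares \<open>(norm (Gm v))\<^sup>2\<close> with a pairing against
      \<open>Gp v\<close>.\<close>
    obtain u where u: "u \<in> D" "Gm u = Gm v" "Gp u = \<Phi> (Gm v)" using traces_onto by blast
    then have "u \<in> graph_dom \<Phi>" by (simp add: graph_dom_def)
    from eq[OF this] have "(norm (Gm v))\<^sup>2 = rp (\<Phi> (Gm v)) (Gp v)"
      using green[OF u(1) v(1)] u v by (simp add: M.norm_sq)
    also have "\<dots> \<le> norm (\<Phi> (Gm v)) * norm (Gp v)" by (rule P.upper_bound)
    also have "\<dots> \<le> norm (Gm v) * norm (Gp v)" by (intro mult_right_mono \<Phi>) auto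
    finally have "norm (Gm v) \<le> norm (Gp v)"
      by (cases "Gm v = 0") (simp_all add: power2_eq_square)
    then have "(norm (Gm v))\<^sup>2 \<le> (norm (Gp v))\<^sup>2" by (intro power_mono) auto
    then have "0 \<le> r (A v) v" using green_self[OF v(1)] by linarith
    also have "r (A v) v = - (1 / h) * (norm v)\<^sup>2"
      unfolding v(2) by (simp only: V.scaleR_left V.norm_sq)
    finally have "(norm v)\<^sup>2 / h \<le> 0" by simp
    then have "(norm v)\<^sup>2 \<le> 0" using h by (simp add: divide_le_0_iff)
    then show "v = 0" by simp
  qed
  ultimately have "?S = UNIV" using V.complete_subspace_eq_UNIV[OF S] by simp
  then have "f \<in> ?S" by simp
  then show ?thesis by auto
qed

section \<open>Completeness of the trace spaces\<close>

lemma eigenvector_of_trace: "\<exists>z\<in>D. A z = z \<and> Gp z = y"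
proof -
  obtain w where w: "w \<in> D" "Gm w = 0" "Gp w = y" using traces_onto by blast
  \<comment> \<open>For \<Phi> = 0 the adjoint is 0. The vector \<open>u\<close> has plus trace zero
    and the same image under 1 - A as \<open>w\<close>, so \<open>w - u\<close> is in the kernel of
    1 - A and keeps the plus trace of \<open>w\<close>.\<close>
  have "linear (\<lambda>x::'m. 0::'p)" by (rule linear_zero)
  then obtain u where u: "u \<in> D" "Gp u = 0" "u - A u = w - A w"
    using graph_dom_range_of_adjoint[of "\<lambda>_. 0" "\<lambda>_. 0" 1 "w - A w"]
    by (auto simp: graph_dom_def P.zero_left M.zero_right)
  show ?thesis
  proof (intro bexI conjI)
    show "w - u \<in> D" using w u D by (simp add: subspace_diff)
    have "A w - A u = w - u" using u(3) by (simp add: algebra_simps)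
    then show "A (w - u) = w - u" using w u by (simp add: A_diff)
    show "Gp (w - u) = y" using w u by (simp add: Gp_diff)
  qed
qed

text \<open>Eigenvectors \<open>z n\<close> with traces \<open>x n\<close> converge in \<open>V\<close>, so \<open>x n\<close> converges weakly; a Cauchy
  sequence converges in norm to its weak limit.\<close>

lemma complete_plus: "complete (UNIV :: 'p set)"
proof (rule completeI)
  fix x :: "nat \<Rightarrow> 'p" assume "Cauchy x"
  have "\<forall>n. \<exists>z. z \<in> D \<and> A z = z \<and> Gp z = x n"
    using eigenvector_of_trace by blast
  then obtain z where z: "\<And>n. z n \<in> D" "\<And>n. A (z n) = z n" "\<And>n. Gp (z n) = x n"
    by metis
  \<comment> \<open>On the kernel of 1 - A, Green's identity reads \<open>2 * (norm z)\<^sup>2 =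
    (norm (Gp z))\<^sup>2 - (norm (Gm z))\<^sup>2\<close>.\<close>
  have le: "norm (z m - z n) \<le> norm (x m - x n)" for m n
  proof -
    have "z m - z n \<in> D" using z D by (simp add: subspace_diff)
    moreover have "A (z m - z n) = z m - z n" "Gp (z m - z n) = x m - x n"
      using z by (simp_all add: A_diff Gp_diff)
    ultimately have "2 * (norm (z m - z n))\<^sup>2 \<le> (norm (x m - x n))\<^sup>2"
      using green_self[of "z m - z n"] by (simp add: V.norm_sq)
    moreover have "0 \<le> (norm (z m - z n))\<^sup>2" by simp
    ultimately have "(norm (z m - z n))\<^sup>2 \<le> (norm (x m - x n))\<^sup>2" by linarith
    then show ?thesis by (rule power2_le_imp_le) simp
  qed
  have "Cauchy z"
    using \<open>Cauchy x\<close> by (rule Cauchy_dominated) (simp add: dist_norm le)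
  then obtain y where y: "z \<longlonglongrightarrow> y" by (auto dest: Cauchy_convergent convergentD)
  then have yD: "y \<in> D" "A y = y" using closed_operator[of z y y] z by auto
  have weak: "(\<lambda>n. rp (x n) a) \<longlonglongrightarrow> rp (Gp y) a" for a
  proof -
    obtain v where v: "v \<in> D" "Gm v = 0" "Gp v = a" using traces_onto by blast
    have eq: "rp (Gp w) a = r (A w) v + r w (A v)" if "w \<in> D" for w
      using green[OF that v(1)] v by (simp add: M.zero_right)
    have "(\<lambda>n. r (z n) v + r (z n) (A v)) \<longlonglongrightarrow> r y v + r y (A v)"
      by (intro tendsto_intros V.tendsto y)
    then show ?thesis using eq[OF yD(1)] eq[OF z(1)] z yD by simp
  qed
  have "x \<longlonglongrightarrow> Gp y"
  proof (rule metric_LIMSEQ_I)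
    fix e :: real assume "e > 0"
    then obtain N where N: "\<And>m n. m \<ge> N \<Longrightarrow> n \<ge> N \<Longrightarrow> norm (x m - x n) < e / 2"
      using \<open>Cauchy x\<close> unfolding Cauchy_def dist_norm by (meson half_gt_zero)
    have "norm (x n - Gp y) < e" if "n \<ge> N" for n
    proof -
      let ?a = "x n - Gp y"
      \<comment> \<open>Fix \<open>n\<close> and let \<open>m\<close> tend to infinity: the pairing
        of \<open>x n - x m\<close> with \<open>?a\<close> is at most
        \<open>e / 2 * norm ?a\<close>, and its limit is \<open>(norm ?a)\<^sup>2\<close>.\<close>
      have "(\<lambda>m. rp (x n) ?a - rp (x m) ?a) \<longlonglongrightarrow> rp (x n) ?a - rp (Gp y) ?a"
        by (intro tendsto_intros weak)
      moreover have "\<forall>\<^sub>F m in sequentially. rp (x n) ?a - rp (x m) ?a \<le> e / 2 * norm ?a"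
      proof (rule eventually_sequentiallyI[of N])
        fix m assume "N \<le> m"
        have "rp (x n) ?a - rp (x m) ?a \<le> norm (x n - x m) * norm ?a"
          using P.upper_bound[of "x n - x m" ?a] by (simp add: P.diff_left)
        also have "\<dots> \<le> e / 2 * norm ?a"
          using N[OF that \<open>N \<le> m\<close>] by (intro mult_right_mono) auto
        finally show "rp (x n) ?a - rp (x m) ?a \<le> e / 2 * norm ?a" .
      qed
      ultimately have "rp (x n) ?a - rp (Gp y) ?a \<le> e / 2 * norm ?a"
        using tendsto_upperbound trivial_limit_sequentially by blast
      then have "norm ?a * norm ?a \<le> e / 2 * norm ?a"
        by (simp only: P.diff_left[symmetric] P.norm_sq power2_eq_square)
      then have "norm ?a \<le> e / 2"
        using \<open>e > 0\<close> by (cases "?a = 0") auto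
      then show ?thesis using \<open>e > 0\<close> by linarith
    qed
    then show "\<exists>N. \<forall>n\<ge>N. dist (x n) (Gp y) < e" unfolding dist_norm by blast
  qed
  then show "\<exists>l\<in>UNIV. x \<longlonglongrightarrow> l" by blast
qed

lemma complete_minus: "complete (UNIV :: 'm set)"
proof -
  interpret swap: boundary_form r rp rm D0 D "\<lambda>u. - A u" Gp Gm by (rule swapped)
  show ?thesis by (rule swap.complete_plus)
qed

text \<open>Completeness of the minus trace space now supplies the adjoint of \<Phi>: for each
  \<open>y\<close>, the functional that pairs \<open>\<Phi> x\<close> with \<open>y\<close> is
  bounded in \<open>x\<close> and has a Riesz vector.\<close>

theorem graph_dom_range:
  assumes \<Phi>: "linear \<Phi>" "\<And>x. norm (\<Phi> x) \<le> norm x" and h: "h > 0"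
  shows "\<exists>u\<in>graph_dom \<Phi>. u - h *\<^sub>R A u = f"
proof -
  have bl: "bounded_linear \<Phi>"
    using \<Phi> by (intro bounded_linear_intro[of _ 1]) (auto simp: linear_add linear_scale)
  have "\<exists>y'. \<forall>x. rp (\<Phi> x) y = rm x y'" for y
    by (intro M.riesz_representation complete_minus bounded_linear_compose[OF P.bounded_linear_left bl])
  then obtain \<Psi> where "\<And>x y. rp (\<Phi> x) y = rm x (\<Psi> y)" by metis
  then show ?thesis using graph_dom_range_of_adjoint[OF \<Phi>] h by blast
qed

section \<open>From maximal dissipative restrictions to contractions of the traces\<close>

lemma dissipative_trace_contraction:
  assumes B: "subspace B" "B \<subseteq> D" and diss: "\<And>u. u \<in> B \<Longrightarrow> r (A u) u \<le> 0"
    and uv: "u \<in> B" "v \<in> B"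
  shows "norm (Gp u - Gp v) \<le> norm (Gm u - Gm v)"
proof -
  have D: "u \<in> D" "v \<in> D" "u - v \<in> B" "u - v \<in> D" using uv B by (auto simp: subspace_diff)
  have "(norm (Gp (u - v)))\<^sup>2 \<le> (norm (Gm (u - v)))\<^sup>2"
    using diss[OF D(3)] green_self[OF D(4)] by linarith
  then have "norm (Gp (u - v)) \<le> norm (Gm (u - v))" by (rule power2_le_imp_le) simp
  then show ?thesis using D by (simp add: Gm_diff Gp_diff)
qed

text \<open>Since \<open>r (A v) v = 0\<close> on \<open>D0\<close>, the form of \<open>B\<close> at
  \<open>u + t *\<^sub>R v\<close> is affine in \<open>t\<close> with slope
  \<open>r (A v) u + r v (B u)\<close>. Being bounded above, it has slope zero, and
  \<open>adjoint\<close> applies.\<close>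

lemma dissipative_extension_restricts:
  assumes S: "subspace S" "D0 \<subseteq> S" and B: "linear_on scaleR scaleR S B"
    and ext: "\<And>u. u \<in> D0 \<Longrightarrow> B u = A u" and diss: "\<And>u. u \<in> S \<Longrightarrow> r (B u) u \<le> 0"
    and u: "u \<in> S"
  shows "u \<in> D \<and> A u = B u"
proof -
  have "r (A v) u + r v (B u) = 0" if v: "v \<in> D0" for v
  proof (rule ccontr)
    let ?b = "r (A v) u + r v (B u)"
    assume b: "?b \<noteq> 0"
    \<comment> \<open>The parameter at which the affine function takes the value 1.\<close>
    define t where "t = (1 - r (B u) u) / ?b"
    have vS: "v \<in> S" "t *\<^sub>R v \<in> S" "u + t *\<^sub>R v \<in> S"
      using v S u by (auto simp: subspace_add subspace_scale)
    have "B (u + t *\<^sub>R v) = B u + t *\<^sub>R A v"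
      using B u vS ext[OF v] by (simp add: linear_on_def)
    then have "r (B u) u + t * ?b + t\<^sup>2 * r (A v) v \<le> 0"
      using diss[OF vS(3)]
      by (simp add: V.add_left V.add_right V.scaleR_left V.scaleR_right V.sym[of v] algebra_simps
          power2_eq_square)
    moreover have "r (A v) v = 0"
    proof -
      have "v \<in> D" using v D0_subset by blast
      then have "r (A v) v + r v (A v) = 0" using adjoint[of v "A v"] v by blast
      then show ?thesis by (simp add: V.sym[of v])
    qed
    moreover have "t * ?b = 1 - r (B u) u" using b by (simp add: t_def)
    ultimately show False by simp
  qed
  then show ?thesis by (simp add: adjoint[symmetric])
qed

text \<open>If the trace space \<open>W\<close> of a maximal dissipative restriction missed \<open>k\<close>, the associated contraction
  would extend to \<open>k\<close>: send it to the limit of the images of a sequence in \<open>W\<close> that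
  converges to the orthogonal projection of \<open>k\<close> onto the closure of \<open>W\<close>.\<close>

lemma maximal_dissipative_trace_onto:
  assumes B: "subspace B" "B \<subseteq> D" and diss: "\<And>u. u \<in> B \<Longrightarrow> r (A u) u \<le> 0"
    and range: "\<And>f. \<exists>u\<in>B. u - A u = f"
  shows "\<exists>u\<in>B. Gm u = k"
proof -
  have contr: "norm (Gp u - Gp v) \<le> norm (Gm u - Gm v)" if "u \<in> B" "v \<in> B" for u v
    by (rule dissipative_trace_contraction[OF B _ that]) (rule diss)
  define W where "W = Gm ` B"
  have "linear_on scaleR scaleR B Gm"
    using Gm_linear B(2) unfolding linear_on_def by blast
  then have "subspace W" unfolding W_def using B(1) by (rule linear_on_image_subspace)
  moreover have "complete (closure W)"
    using complete_closed_subset[OF closed_closure subset_UNIV complete_minus] .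
  ultimately obtain p where p: "p \<in> closure W" "\<And>s. s \<in> closure W \<Longrightarrow> rm (k - p) s = 0"
    using M.orthogonal_projection[OF subspace_closure, of W k] by blast
  obtain q where "\<And>n. q n \<in> W" and q_lim: "q \<longlonglongrightarrow> p"
    using p(1) unfolding closure_sequential by blast
  then have "\<forall>n. \<exists>u. u \<in> B \<and> q n = Gm u" unfolding W_def by blast
  then obtain u where u: "\<And>n. u n \<in> B" "\<And>n. q n = Gm (u n)" by metis
  have "Cauchy (\<lambda>n. Gp (u n))"
    using LIMSEQ_imp_Cauchy[OF q_lim]
    by (rule Cauchy_dominated) (simp add: dist_norm u(2) contr[OF u(1) u(1)])
  then obtain y where y: "(\<lambda>n. Gp (u n)) \<longlonglongrightarrow> y"
    using complete_plus unfolding complete_def by blast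
  have dist_le: "norm (y - Gp b) \<le> norm (k - Gm b)" if b: "b \<in> B" for b
  proof -
    have "norm (y - Gp b) \<le> norm (p - Gm b)"
    proof (rule LIMSEQ_le)
      show "(\<lambda>n. norm (Gp (u n) - Gp b)) \<longlonglongrightarrow> norm (y - Gp b)" by (intro tendsto_intros y)
      show "(\<lambda>n. norm (Gm (u n) - Gm b)) \<longlonglongrightarrow> norm (p - Gm b)"
        unfolding u(2)[symmetric] by (intro tendsto_intros q_lim)
      show "\<exists>N. \<forall>n\<ge>N. norm (Gp (u n) - Gp b) \<le> norm (Gm (u n) - Gm b)"
        using contr[OF u(1) b] by blast
    qed
    \<comment> \<open>Pythagoras: \<open>p\<close> is the projection of \<open>k\<close>, and
      \<open>p - Gm b\<close> lies in the closure of \<open>W\<close>.\<close>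
    moreover have "rm (k - p) (p - Gm b) = 0"
    proof -
      have "Gm b \<in> W" using b by (simp add: W_def)
      then have "rm (k - p) (Gm b) = 0" using p(2) closure_subset[of W] by auto
      then show ?thesis using p(2)[OF p(1)] by (simp add: M.diff_right)
    qed
    then have "(norm (k - Gm b))\<^sup>2 = (norm (k - p))\<^sup>2 + (norm (p - Gm b))\<^sup>2"
      using M.norm_add_sq[of "k - p" "p - Gm b"] by simp
    then have "(norm (p - Gm b))\<^sup>2 \<le> (norm (k - Gm b))\<^sup>2" by simp
    then have "norm (p - Gm b) \<le> norm (k - Gm b)" by (rule power2_le_imp_le) simp
    ultimately show ?thesis by linarith
  qed
  \<comment> \<open>The candidate for the extension has traces \<open>(k, y)\<close>. Choosing
    \<open>b\<close> in \<open>B\<close> with \<open>w - b\<close> in the kernel of 1 - A gives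
    Green's identity a nonnegative left and a nonpositive right side, so \<open>w\<close> is already
    in \<open>B\<close>.\<close>
  obtain w where w: "w \<in> D" "Gm w = k" "Gp w = y" using traces_onto by blast
  obtain b where b: "b \<in> B" "b - A b = w - A w" using range[of "w - A w"] by auto
  have bD: "b \<in> D" "w - b \<in> D" using b B w D by (auto simp: subspace_diff)
  have "A w - A b = w - b" using b(2) by (simp add: algebra_simps)
  then have "2 * (norm (w - b))\<^sup>2 = (norm (y - Gp b))\<^sup>2 - (norm (k - Gm b))\<^sup>2"
    using green_self[OF bD(2)] w bD by (simp add: A_diff Gm_diff Gp_diff V.norm_sq)
  also have "\<dots> \<le> 0" using dist_le[OF b(1)] by (simp add: power_mono)
  finally have "w = b" by simp
  then have "Gm b = k" using w(2) by simp
  with b(1) show ?thesis by (rule bexI[rotated])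
qed

lemma maximal_dissipative_graph:
  assumes B: "subspace B" "B \<subseteq> D" and diss: "\<And>u. u \<in> B \<Longrightarrow> r (A u) u \<le> 0"
    and range: "\<And>f. \<exists>u\<in>B. u - A u = f"
  shows "\<exists>\<Phi>. (\<forall>u\<in>B. \<Phi> (Gm u) = Gp u) \<and> (\<forall>x. norm (\<Phi> x) \<le> norm x) \<and> B = graph_dom \<Phi>"
proof -
  have contr: "norm (Gp u - Gp v) \<le> norm (Gm u - Gm v)" if "u \<in> B" "v \<in> B" for u v
    by (rule dissipative_trace_contraction[OF B _ that]) (rule diss)
  have "\<forall>x. \<exists>u. u \<in> B \<and> Gm u = x"
    using maximal_dissipative_trace_onto[OF B diss range] by blast
  then obtain s where s: "\<And>x. s x \<in> B" "\<And>x. Gm (s x) = x" by metis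
  define \<Phi> where "\<Phi> x = Gp (s x)" for x
  \<comment> \<open>Equal minus traces force equal plus traces, so the choice made by
    \<open>s\<close> does not affect \<Phi>.\<close>
  have \<Phi>: "\<Phi> (Gm u) = Gp u" if "u \<in> B" for u
    using contr[OF s(1) that, of "Gm u"] by (simp add: s(2) \<Phi>_def)
  have "norm (\<Phi> x) \<le> norm x" for x
  proof -
    have "0 \<in> B" "0 \<in> D" using B by (auto simp: subspace_0)
    moreover have "Gm 0 = 0" "Gp 0 = 0"
      using Gm_diff[of 0 0] Gp_diff[of 0 0] \<open>0 \<in> D\<close> by auto
    ultimately show ?thesis using contr[OF s(1), of 0 x] by (simp add: s(2) \<Phi>_def)
  qed
  moreover have "B = graph_dom \<Phi>"
  proof
    show "B \<subseteq> graph_dom \<Phi>" using B(2) \<Phi> by (auto simp: graph_dom_def)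
    show "graph_dom \<Phi> \<subseteq> B"
    proof
      fix w assume "w \<in> graph_dom \<Phi>"
      then have w: "w \<in> D" "Gp w = Gp (s (Gm w))" by (auto simp: graph_dom_def \<Phi>_def)
      \<comment> \<open>Again \<open>w - b\<close> is in the kernel of 1 - A; \<open>contr\<close>
        applies to its traces because \<open>w\<close> has the same traces as
        \<open>s (Gm w)\<close>, a vector of \<open>B\<close>.\<close>
      obtain b where b: "b \<in> B" "b - A b = w - A w" using range[of "w - A w"] by auto
      have bD: "b \<in> D" "w - b \<in> D" using b B w D by (auto simp: subspace_diff)
      have "A w - A b = w - b" using b(2) by (simp add: algebra_simps)
      then have "2 * (norm (w - b))\<^sup>2 = (norm (Gp w - Gp b))\<^sup>2 - (norm (Gm w - Gm b))\<^sup>2"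
        using green_self[OF bD(2)] w(1) bD by (simp add: A_diff Gm_diff Gp_diff V.norm_sq)
      also have "\<dots> \<le> 0"
        using contr[OF s(1) b(1), of "Gm w"] by (simp add: w(2) s(2) power_mono)
      finally show "w \<in> B" using b(1) by simp
    qed
  qed
  ultimately show ?thesis using \<Phi> by blast
qed

end

section \<open>Generators of contraction semigroups\<close>

lemma has_vector_derivative_right_quotient:
  assumes "(F has_vector_derivative d) (at a within {a..b})" "a < b"
  shows "((\<lambda>h. (1 / h) *\<^sub>R (F (a + h) - F a)) \<longlongrightarrow> d) (at_right 0)"
proof -
  have "((\<lambda>y. (F y - (F a + (y - a) *\<^sub>R d)) /\<^sub>R norm (y - a)) \<longlongrightarrow> 0) (at_right a)"
    using assms by (simp add: has_vector_derivative_def has_derivative_at_within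
        at_within_Icc_at_right diff_diff_eq)
  then have "((\<lambda>h. (F (h + a) - (F a + h *\<^sub>R d)) /\<^sub>R norm h) \<longlongrightarrow> 0) (at_right 0)"
    by (simp add: filterlim_at_right_to_0[of _ _ a])
  then have "((\<lambda>h. (F (h + a) - (F a + h *\<^sub>R d)) /\<^sub>R norm h + d) \<longlongrightarrow> 0 + d) (at_right 0)"
    by (intro tendsto_intros)
  moreover have "\<forall>\<^sub>F h in at_right 0.
      (F (h + a) - (F a + h *\<^sub>R d)) /\<^sub>R norm h + d = (1 / h) *\<^sub>R (F (a + h) - F a)"
    using eventually_at_right_less[of 0]
    by eventually_elim (simp add: algebra_simps divide_inverse)
  ultimately show ?thesis by (auto intro: Lim_transform_eventually)
qed

locale contraction_semigroup =
  fixes smul :: "'k::field \<Rightarrow> 'v::banach \<Rightarrow> 'v" and T :: "real \<Rightarrow> 'v \<Rightarrow> 'v"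
  assumes C0: "C0_semigroup smul T" and contraction: "t \<ge> 0 \<Longrightarrow> norm (T t x) \<le> norm x"
begin

lemma bounded_linear_T: "t \<ge> 0 \<Longrightarrow> bounded_linear (T t)"
  using C0 by (simp add: C0_semigroup_def)

lemmas T_diff = bounded_linear_T[THEN bounded_linear.linear, THEN linear_diff]
  and T_scaleR = bounded_linear_T[THEN bounded_linear.linear, THEN linear_scale]

lemma T_0: "T 0 x = x"
  using C0 by (simp add: C0_semigroup_def)

lemma T_add: "s \<ge> 0 \<Longrightarrow> t \<ge> 0 \<Longrightarrow> T (s + t) x = T s (T t x)"
  using C0 by (simp add: C0_semigroup_def)

lemma norm_T_diff_le:
  assumes "0 \<le> s" "s \<le> t"
  shows "norm (T t x - T s x) \<le> norm (T (t - s) x - x)"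
proof -
  have "T t x - T s x = T s (T (t - s) x - x)"
    using assms T_add[of s "t - s" x] by (simp add: T_diff)
  then show ?thesis using contraction assms by simp
qed

text \<open>For \<open>u \<le> t\<close> the increment of the orbit is \<open>T u\<close> applied to
  the increment from 0 to \<open>t - u\<close>; contractivity thus reduces continuity from both
  sides to right continuity at 0.\<close>

lemma orbit_continuous: "continuous_on {0..} (\<lambda>t. T t x)"
  unfolding continuous_on_iff
proof (intro ballI allI impI)
  fix s e :: real assume s: "s \<in> {0..}" and e: "e > 0"
  have "((\<lambda>t. T t x) \<longlongrightarrow> x) (at_right 0)"
    using C0 by (simp add: C0_semigroup_def)
  then have "\<forall>\<^sub>F t in at_right 0. dist (T t x) x < e"
    using e by (rule tendstoD)
  then obtain d where d: "d > 0" "\<And>t. 0 < t \<Longrightarrow> t < d \<Longrightarrow> dist (T t x) x < e"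
    unfolding eventually_at_right_field by auto
  have close: "norm (T t x - T u x) < e" if "0 \<le> u" "u \<le> t" "t - u < d" for t u
  proof (cases "u = t")
    case False
    then show ?thesis
      using norm_T_diff_le[OF that(1,2), of x] d(2)[of "t - u"] that by (simp add: dist_norm)
  qed (use e in simp)
  have "dist (T t x) (T s x) < e" if "t \<in> {0..}" "dist t s < d" for t
    using close[of s t] close[of t s] that s
    by (cases "s \<le> t") (auto simp: dist_norm norm_minus_commute dist_real_def)
  then show "\<exists>d>0. \<forall>t\<in>{0..}. dist t s < d \<longrightarrow> dist (T t x) (T s x) < e"
    using d(1) by blast
qed

lemma generator_dissipative:
  assumes "inner_form r" "generator_of B T" "x \<in> op_dom B"
  shows "r (op_app B x) x \<le> 0"
proof -
  interpret inner_form r by fact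
  have "((\<lambda>t. (1 / t) *\<^sub>R (T t x - x)) \<longlongrightarrow> op_app B x) (at_right 0)"
    using assms by (simp add: generator_of_def)
  then have "((\<lambda>t. r ((1 / t) *\<^sub>R (T t x - x)) x) \<longlongrightarrow> r (op_app B x) x) (at_right 0)"
    by (intro tendsto tendsto_const)
  moreover have "\<forall>\<^sub>F t in at_right 0. r ((1 / t) *\<^sub>R (T t x - x)) x \<le> 0"
    using eventually_at_right_less[of 0]
  proof eventually_elim
    case (elim t)
    have "r (T t x) x \<le> norm (T t x) * norm x" by (rule upper_bound)
    also have "\<dots> \<le> norm x * norm x" using contraction elim by (intro mult_right_mono) auto
    finally have "r (T t x - x) x \<le> 0" by (simp add: diff_left norm_sq power2_eq_square)
    then show ?case using elim by (simp add: scaleR_left divide_le_0_iff)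
  qed
  ultimately show ?thesis by (rule tendsto_upperbound) simp
qed

text \<open>With \<open>x = f + e\<^sup>-\<^sup>1 T 1 x\<close> and \<open>S t = e\<^sup>-\<^sup>t T t x\<close>, the vector \<open>u = \<integral>\<^sub>0\<^sup>1 S\<close> satisfies
  \<open>B u - u = S 1 - S 0 = - f\<close>.\<close>

lemma generator_range:
  assumes B: "generator_of B T"
  shows "\<exists>u\<in>op_dom B. u - op_app B u = f"
proof -
  \<comment> \<open>The fixed point \<open>x\<close> is the sum of
    \<open>exp (- n) *\<^sub>R T n f\<close>, so the integral of \<open>S\<close> over the unit
    interval equals the Laplace integral of the orbit of \<open>f\<close> over the half
    line.\<close>
  let ?g = "\<lambda>x. f + exp (- 1) *\<^sub>R T 1 x"
  have "dist (?g x) (?g y) \<le> exp (- 1) * dist x y" for x y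
  proof -
    have "?g x - ?g y = exp (- 1) *\<^sub>R T 1 (x - y)" by (simp add: T_diff scaleR_diff_right)
    then show ?thesis using contraction[of 1 "x - y"] by (simp add: dist_norm)
  qed
  then obtain x where x: "?g x = x"
    using banach_fix_type[of "exp (- 1)" ?g] by auto
  define S where "S t = exp (- t) *\<^sub>R T t x" for t
  define F where "F a = integral {0..a} S" for a
  define u where "u = F 1"
  have S_cont: "continuous_on {a..b} S" if "a \<ge> 0" for a b
    unfolding S_def using that
    by (intro continuous_intros continuous_on_subset[OF orbit_continuous]) auto
  have S_int: "S integrable_on {a..b}" if "a \<ge> 0" for a b
    using S_cont[OF that] by (rule integrable_continuous_real)
  \<comment> \<open>The interval extends to 2 so that a right derivative is available at 1 as well
    as at 0.\<close>
  have F_deriv: "(F has_vector_derivative S a) (at a within {a..2})" if "a \<in> {0..2}" for a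
  proof -
    have "(F has_vector_derivative S a) (at a within {0..2})"
      unfolding F_def using S_cont that by (intro integral_has_vector_derivative) auto
    then show ?thesis by (rule has_vector_derivative_within_subset) (use that in auto)
  qed
  \<comment> \<open>Applying \<open>T h\<close> shifts the interval of integration by
    \<open>h\<close> at the cost of a factor \<open>exp h\<close>; only the pieces at its two ends
    and that factor contribute to the quotient.\<close>
  have quot: "(1 / h) *\<^sub>R (T h u - u) = exp h *\<^sub>R ((1 / h) *\<^sub>R (F (1 + h) - F 1))
      - exp h *\<^sub>R ((1 / h) *\<^sub>R (F (0 + h) - F 0)) + ((exp h - 1) / h) *\<^sub>R u"
    if h: "h > 0" for h
  proof -
    have "T h u = integral {0..1} (T h \<circ> S)"
      unfolding u_def F_def using integral_linear[OF S_int bounded_linear_T] h by simp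
    also have "\<dots> = integral {0..1} (\<lambda>t. exp h *\<^sub>R (S \<circ> (+) h) t)"
    proof (rule integral_cong)
      fix t :: real assume "t \<in> {0..1}"
      then show "(T h \<circ> S) t = exp h *\<^sub>R (S \<circ> (+) h) t"
        using h by (simp add: S_def T_add T_scaleR exp_add[symmetric])
    qed
    also have "\<dots> = exp h *\<^sub>R integral {0 + h..1 + h} S"
      by (simp only: integral_cmul integral_shift_Icc_real)
    also have "integral {0 + h..1 + h} S = F (1 + h) - F h"
      using Henstock_Kurzweil_Integration.integral_combine[of 0 h "1 + h" S] S_int[of 0] h
      by (simp add: F_def algebra_simps)
    finally have Thu: "T h u = exp h *\<^sub>R (F (1 + h) - F h)" .
    have "F 0 = 0" by (simp add: F_def)
    then show ?thesis
      unfolding Thu by (simp add: u_def algebra_simps diff_divide_distrib)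
  qed
  have "((\<lambda>h. exp h *\<^sub>R ((1 / h) *\<^sub>R (F (1 + h) - F 1))
      - exp h *\<^sub>R ((1 / h) *\<^sub>R (F (0 + h) - F 0)) + ((exp h - 1) / h) *\<^sub>R u)
      \<longlongrightarrow> exp 0 *\<^sub>R S 1 - exp 0 *\<^sub>R S 0 + 1 *\<^sub>R u) (at_right 0)"
  proof (intro tendsto_intros has_vector_derivative_right_quotient[OF F_deriv])
    show "((\<lambda>h. (exp h - 1) / h) \<longlongrightarrow> 1) (at_right (0::real))"
      using DERIV_exp[of "0::real"]
      by (auto simp: has_field_derivative_iff intro: tendsto_mono[OF at_le])
  qed auto
  then have "((\<lambda>h. (1 / h) *\<^sub>R (T h u - u)) \<longlongrightarrow> exp 0 *\<^sub>R S 1 - exp 0 *\<^sub>R S 0 + 1 *\<^sub>R u) (at_right 0)"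
    by (rule Lim_transform_eventually)
      (use quot in \<open>auto intro!: eventually_mono[OF eventually_at_right_less[of 0]]\<close>)
  also have "exp 0 *\<^sub>R S 1 - exp 0 *\<^sub>R S 0 + 1 *\<^sub>R u = u - f"
  proof -
    have "S 0 = f + S 1" using x by (simp add: S_def T_0)
    then show ?thesis by simp
  qed
  finally have lim: "((\<lambda>h. (1 / h) *\<^sub>R (T h u - u)) \<longlongrightarrow> u - f) (at_right 0)" .
  then have dom: "u \<in> op_dom B" using B unfolding generator_of_def by blast
  then have "((\<lambda>h. (1 / h) *\<^sub>R (T h u - u)) \<longlongrightarrow> op_app B u) (at_right 0)"
    using B by (simp add: generator_of_def)
  then have "op_app B u = u - f" using lim by (rule tendsto_unique[rotated]) simp
  then show ?thesis using dom by (auto intro: bexI[of _ u])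
qed

end

section \<open>Generation by the implicit Euler scheme\<close>

lemma norm_add_diff_le:
  fixes a b c :: "'a::real_normed_vector"
  shows "norm (a + b - c) \<le> norm a + norm b + norm c"
  using norm_triangle_ineq4[of "a + b" c] norm_triangle_ineq[of a b] by linarith

lemma dense_approx:
  fixes S :: "'a::real_normed_vector set"
  assumes "closure S = UNIV" "e > 0"
  obtains s where "s \<in> S" "norm (x - s) < e"
proof -
  have "x \<in> closure S" using assms(1) by simp
  then have "\<exists>s\<in>S. dist s x < e" unfolding closure_approachable using assms(2) by simp
  then show ?thesis using that by (auto simp: dist_norm norm_minus_commute)
qed

lemma convergent_on_dense:
  fixes L :: "nat \<Rightarrow> 'a::real_normed_vector \<Rightarrow> 'b::banach"
  assumes L: "\<And>n. linear (L n)" "\<And>n x. norm (L n x) \<le> norm x"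
    and dense: "closure S = UNIV" and conv: "\<And>x. x \<in> S \<Longrightarrow> convergent (\<lambda>n. L n x)"
  shows "convergent (\<lambda>n. L n x)"
proof -
  have "Cauchy (\<lambda>n. L n x)"
  proof (rule metric_CauchyI)
    fix e :: real assume "e > 0"
    then obtain s where s: "s \<in> S" "norm (x - s) < e / 3"
      using dense_approx[OF dense, of "e / 3"] by auto
    have "Cauchy (\<lambda>n. L n s)" using conv[OF s(1)] by (rule convergent_Cauchy)
    then obtain N where N: "\<And>m n. m \<ge> N \<Longrightarrow> n \<ge> N \<Longrightarrow> norm (L m s - L n s) < e / 3"
      using metric_CauchyD[of "\<lambda>n. L n s" "e / 3"] \<open>e > 0\<close> by (auto simp: dist_norm)
    have "norm (L m x - L n x) < e" if "m \<ge> N" "n \<ge> N" for m n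
    proof -
      have "L m x - L n x = L m (x - s) + (L m s - L n s) - L n (x - s)"
        by (simp add: linear_diff[OF L(1)])
      then have "norm (L m x - L n x) \<le> norm (L m (x - s)) + norm (L m s - L n s) + norm (L n (x - s))"
        by (simp only: norm_add_diff_le)
      then show ?thesis
        using N[OF that] L(2)[of m "x - s"] L(2)[of n "x - s"] s(2) by linarith
    qed
    then show "\<exists>M. \<forall>m\<ge>M. \<forall>n\<ge>M. dist (L m x) (L n x) < e" by (auto simp: dist_norm)
  qed
  then show ?thesis by (rule Cauchy_convergent)
qed

lemma tendsto_id_on_dense:
  fixes L :: "'i \<Rightarrow> 'a::real_normed_vector \<Rightarrow> 'a"
  assumes L: "\<forall>\<^sub>F i in F. linear (L i) \<and> (\<forall>x. norm (L i x) \<le> norm x)"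
    and dense: "closure S = UNIV" and lim: "\<And>x. x \<in> S \<Longrightarrow> ((\<lambda>i. L i x) \<longlongrightarrow> x) F"
  shows "((\<lambda>i. L i x) \<longlongrightarrow> x) F"
proof (rule tendstoI)
  fix e :: real assume "e > 0"
  then obtain s where s: "s \<in> S" "norm (x - s) < e / 3"
    using dense_approx[OF dense, of "e / 3"] by auto
  have "\<forall>\<^sub>F i in F. dist (L i s) s < e / 3"
    using \<open>e > 0\<close> by (intro tendstoD lim s) auto
  with L show "\<forall>\<^sub>F i in F. dist (L i x) x < e"
  proof eventually_elim
    case (elim i)
    then have "L i x - x = L i (x - s) + (L i s - s) - (x - s)" by (simp add: linear_diff)
    then have "norm (L i x - x) \<le> norm (L i (x - s)) + norm (L i s - s) + norm (x - s)"
      by (simp only: norm_add_diff_le)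
    moreover have "norm (L i (x - s)) \<le> norm (x - s)" "norm (L i s - s) < e / 3"
      using elim by (auto simp: dist_norm)
    ultimately show ?case using s(2) unfolding dist_norm by linarith
  qed
qed

lemma linear_funpow:
  fixes f :: "'a::real_vector \<Rightarrow> 'a"
  shows "linear f \<Longrightarrow> linear (f ^^ n)"
  by (induction n) (auto simp: linear_iff)

lemma norm_funpow_le:
  fixes f :: "'a::real_normed_vector \<Rightarrow> 'a"
  assumes "\<And>x. norm (f x) \<le> norm x"
  shows "norm ((f ^^ n) x) \<le> norm x"
  by (induction n) (auto intro: order_trans[OF assms])

text \<open>Dissipativity is taken as a norm estimate, its Banach space form, since this is exactly
  what bounds the resolvents by 1.\<close>

locale m_dissipative =
  fixes D :: "'v::banach set" and B :: "'v \<Rightarrow> 'v"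
  assumes D: "subspace D" and B_linear: "linear_on scaleR scaleR D B"
    and dense: "closure D = UNIV"
    and dissipative: "h > 0 \<Longrightarrow> u \<in> D \<Longrightarrow> norm u \<le> norm (u - h *\<^sub>R B u)"
    and range: "h > 0 \<Longrightarrow> \<exists>u\<in>D. u - h *\<^sub>R B u = f"
begin

section \<open>Resolvents as implicit Euler steps\<close>

lemmas B_diff = linear_on_diff[OF B_linear D]

lemma B_add: "x \<in> D \<Longrightarrow> y \<in> D \<Longrightarrow> B (x + y) = B x + B y"
  and B_scaleR: "x \<in> D \<Longrightarrow> B (c *\<^sub>R x) = c *\<^sub>R B x"
  using B_linear by (auto simp: linear_on_def)

text \<open>The resolvent of \<open>B\<close> in the form of the inverse of 1 - h B: one implicit
  Euler step of length \<open>h\<close>.\<close>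

definition J :: "real \<Rightarrow> 'v \<Rightarrow> 'v"
  where "J h f = (THE u. u \<in> D \<and> u - h *\<^sub>R B u = f)"

lemma J_eq:
  assumes h: "h > 0" and u: "u \<in> D" "u - h *\<^sub>R B u = f"
  shows "J h f = u"
  unfolding J_def
proof (rule the_equality)
  fix v assume v: "v \<in> D \<and> v - h *\<^sub>R B v = f"
  have "(v - u) - h *\<^sub>R B (v - u) = (v - h *\<^sub>R B v) - (u - h *\<^sub>R B u)"
    using u(1) conjunct1[OF v] by (simp add: B_diff algebra_simps)
  also have "\<dots> = 0" by (simp only: u(2) conjunct2[OF v] diff_self)
  finally have "(v - u) - h *\<^sub>R B (v - u) = 0" .
  then have "norm (v - u) \<le> 0"
    using dissipative[OF h, of "v - u"] u v D by (simp add: subspace_diff)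
  then show "v = u" by simp
qed (use u in simp)

lemma J_dom: "h > 0 \<Longrightarrow> J h f \<in> D"
  and J_inverse: "h > 0 \<Longrightarrow> J h f - h *\<^sub>R B (J h f) = f"
  using range[of h f] J_eq[of h _ f] by auto

lemma J_linear: "h > 0 \<Longrightarrow> linear (J h)"
proof (rule linearI)
  fix x y c assume h: "h > 0"
  show "J h (x + y) = J h x + J h y"
  proof (rule J_eq[OF h])
    have "J h x + J h y - h *\<^sub>R B (J h x + J h y) =
        (J h x - h *\<^sub>R B (J h x)) + (J h y - h *\<^sub>R B (J h y))"
      using J_dom[OF h] by (simp add: B_add scaleR_add_right)
    then show "J h x + J h y - h *\<^sub>R B (J h x + J h y) = x + y" using J_inverse[OF h] by simp
  qed (use D J_dom[OF h] in \<open>simp add: subspace_add\<close>)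
  show "J h (c *\<^sub>R x) = c *\<^sub>R J h x"
  proof (rule J_eq[OF h])
    have "c *\<^sub>R J h x - h *\<^sub>R B (c *\<^sub>R J h x) = c *\<^sub>R (J h x - h *\<^sub>R B (J h x))"
      using J_dom[OF h] by (simp add: B_scaleR scaleR_diff_right)
    then show "c *\<^sub>R J h x - h *\<^sub>R B (c *\<^sub>R J h x) = c *\<^sub>R x" using J_inverse[OF h] by simp
  qed (use D J_dom[OF h] in \<open>simp add: subspace_scale\<close>)
qed

lemma J_norm: "h > 0 \<Longrightarrow> norm (J h x) \<le> norm x"
  using dissipative[OF _ J_dom, of h h x] J_inverse[of h x] by simp

lemma J_diff_eq:
  assumes "h > 0" "u \<in> D"
  shows "J h u - u = h *\<^sub>R J h (B u)"
proof -
  have "J h (u - h *\<^sub>R B u) = u" using assms by (intro J_eq) auto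
  then show ?thesis
    using linear_diff[OF J_linear] linear_scale[OF J_linear] assms by (simp add: algebra_simps)
qed

lemma B_J:
  assumes "h > 0" "u \<in> D"
  shows "B (J h u) = J h (B u)"
proof -
  have "h *\<^sub>R B (J h u) = J h u - (J h u - h *\<^sub>R B (J h u))" by simp
  also have "\<dots> = h *\<^sub>R J h (B u)" by (simp only: J_inverse[OF assms(1)] J_diff_eq[OF assms])
  finally have "h *\<^sub>R B (J h u) = h *\<^sub>R J h (B u)" .
  then show ?thesis using assms(1) by simp
qed

lemmas J_pow_diff = linear_diff[OF linear_funpow[OF J_linear]]
  and J_pow_norm = norm_funpow_le[OF J_norm]

lemma J_step: "h > 0 \<Longrightarrow> u \<in> D \<Longrightarrow> norm (J h u - u) \<le> h * norm (B u)"
  using J_norm[of h "B u"] by (simp add: J_diff_eq)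

lemma J_pow_step:
  assumes "h > 0" "u \<in> D"
  shows "norm ((J h ^^ m) u - u) \<le> real m * h * norm (B u)"
proof (induction m)
  case (Suc m)
  have "(J h ^^ Suc m) u - u = (J h ^^ m) (J h u - u) + ((J h ^^ m) u - u)"
    by (simp add: J_pow_diff[OF assms(1)] funpow_Suc_right del: funpow.simps)
  then have "norm ((J h ^^ Suc m) u - u) \<le> norm (J h u - u) + norm ((J h ^^ m) u - u)"
    by (simp only: norm_triangle_mono[OF J_pow_norm[OF assms(1)] order_refl])
  then show ?case using Suc J_step[OF assms] by (simp add: algebra_simps)
qed simp

text \<open>The resolvent identity behind the consistency of the implicit Euler scheme under halving of
  the step: \<open>(1 - k B)\<^sup>2 y = (1 - 2 k B) y + k\<^sup>2 B\<^sup>2 y\<close>.\<close>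

lemma J_halve_step:
  assumes k: "k > 0" and x: "x \<in> D" "B x \<in> D"
  shows "norm (J k (J k x) - J (2 * k) x) \<le> k\<^sup>2 * norm (B (B x))"
proof -
  have h: "2 * k > 0" using k by simp
  define y where "y = J (2 * k) x"
  have y: "y \<in> D" "B y \<in> D" "B (B y) = J (2 * k) (B (B x))"
    using J_dom[OF h] x by (simp_all add: y_def B_J[OF h])
  have y_inverse: "y - (2 * k) *\<^sub>R B y = x" unfolding y_def by (rule J_inverse[OF h])
  have yk: "y - k *\<^sub>R B y \<in> D" using y(1,2) D by (simp add: subspace_diff subspace_scale)
  have Byk: "B (y - k *\<^sub>R B y) = B y - k *\<^sub>R B (B y)"
    using y(1,2) D by (simp add: B_diff B_scaleR subspace_scale)
  have "(y - k *\<^sub>R B y) - k *\<^sub>R B (y - k *\<^sub>R B y) = (y - (2 * k) *\<^sub>R B y) + k\<^sup>2 *\<^sub>R B (B y)"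
    unfolding Byk mult_2 scaleR_add_left power2_eq_square
    by (simp only: scaleR_diff_right scaleR_scaleR) simp
  also have "\<dots> = x + k\<^sup>2 *\<^sub>R B (B y)" by (simp only: y_inverse)
  finally have Jy: "J k (x + k\<^sup>2 *\<^sub>R B (B y)) = y - k *\<^sub>R B y" by (rule J_eq[OF k yk])
  have "J k (y - k *\<^sub>R B y) = y" using y(1) by (intro J_eq[OF k]) auto
  then have "J k (J k (x + k\<^sup>2 *\<^sub>R B (B y))) = y" by (simp only: Jy)
  then have sum: "J k (J k x) + k\<^sup>2 *\<^sub>R J k (J k (B (B y))) = y"
    by (simp only: linear_add[OF J_linear[OF k]] linear_scale[OF J_linear[OF k]])
  have "norm (a - c) = norm b" if "a + b = c" for a b c :: 'v
    using that by auto
  from this[OF sum] have "norm (J k (J k x) - y) = k\<^sup>2 * norm (J k (J k (B (B y))))"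
    by (simp only: norm_scaleR abs_power2)
  also have "\<dots> \<le> k\<^sup>2 * norm (B (B x))"
  proof (rule mult_left_mono)
    have "norm (J k (J k (B (B y)))) \<le> norm (J k (B (B y)))" by (rule J_norm[OF k])
    also have "\<dots> \<le> norm (B (B y))" by (rule J_norm[OF k])
    also have "\<dots> \<le> norm (B (B x))" unfolding y(3) by (rule J_norm[OF h])
    finally show "norm (J k (J k (B (B y)))) \<le> norm (B (B x))" .
  qed simp
  finally show ?thesis unfolding y_def .
qed

text \<open>The errors of the double steps merely add up: later steps do not enlarge them, by
  contractivity, and \<open>norm (B (B x))\<close> does not grow along the iterates, because
  \<open>B\<close> commutes with the resolvent.\<close>

lemma J_pow_halve_step:
  assumes k: "k > 0" and x: "x \<in> D" "B x \<in> D"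
  shows "norm ((J k ^^ (2 * m)) x - (J (2 * k) ^^ m) x) \<le> real m * (k\<^sup>2 * norm (B (B x)))"
  using x
proof (induction m arbitrary: x)
  case (Suc m)
  have h: "2 * k > 0" using k by simp
  let ?y = "J (2 * k) x"
  have y: "?y \<in> D" "B ?y \<in> D" "B (B ?y) = J (2 * k) (B (B x))"
    using Suc.prems by (simp_all add: J_dom[OF h] B_J[OF h])
  have "(J k ^^ (2 * Suc m)) x - (J (2 * k) ^^ Suc m) x =
      (J k ^^ (2 * m)) (J k (J k x) - ?y) + ((J k ^^ (2 * m)) ?y - (J (2 * k) ^^ m) ?y)"
    by (simp add: J_pow_diff[OF k] funpow_Suc_right del: funpow.simps)
  then have "norm ((J k ^^ (2 * Suc m)) x - (J (2 * k) ^^ Suc m) x) \<le>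
      norm ((J k ^^ (2 * m)) (J k (J k x) - ?y)) + norm ((J k ^^ (2 * m)) ?y - (J (2 * k) ^^ m) ?y)"
    by (simp only: norm_triangle_ineq)
  also have "\<dots> \<le> k\<^sup>2 * norm (B (B x)) + real m * (k\<^sup>2 * norm (B (B x)))"
  proof (rule add_mono)
    show "norm ((J k ^^ (2 * m)) (J k (J k x) - ?y)) \<le> k\<^sup>2 * norm (B (B x))"
      using J_pow_norm[OF k] J_halve_step[OF k Suc.prems] by (rule order_trans)
    show "norm ((J k ^^ (2 * m)) ?y - (J (2 * k) ^^ m) ?y) \<le> real m * (k\<^sup>2 * norm (B (B x)))"
      using Suc.IH[OF y(1,2)] J_norm[OF h, of "B (B x)"] y(3)
      by (smt (verit, best) mult_left_mono of_nat_0_le_iff zero_le_power2)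
  qed
  finally show ?case by (simp add: algebra_simps)
qed simp

text \<open>The Euler scheme with step \<open>1 / 2 ^ n\<close>, stopped at the last grid point not
  after \<open>t\<close>.\<close>

definition E :: "nat \<Rightarrow> real \<Rightarrow> 'v \<Rightarrow> 'v"
  where "E n t = J (1 / 2 ^ n) ^^ nat \<lfloor>t * 2 ^ n\<rfloor>"

lemma E_linear: "linear (E n t)"
  unfolding E_def by (intro linear_funpow J_linear) simp

lemma E_norm: "norm (E n t x) \<le> norm x"
  unfolding E_def by (rule J_pow_norm) simp

lemma step_count_le: "t \<ge> 0 \<Longrightarrow> real (nat \<lfloor>t * 2 ^ n\<rfloor>) * (1 / 2 ^ n) \<le> t"
  by (simp add: divide_le_eq)

lemma step_count_tendsto:
  assumes "t \<ge> 0"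
  shows "(\<lambda>n. real (nat \<lfloor>t * 2 ^ n\<rfloor>) * (1 / 2 ^ n)) \<longlonglongrightarrow> t"
proof (rule real_tendsto_sandwich)
  have "(\<lambda>n. t - (1 / 2) ^ n) \<longlonglongrightarrow> t - 0"
    by (intro tendsto_intros LIMSEQ_power_zero) simp
  then show "(\<lambda>n. t - (1 / 2) ^ n) \<longlonglongrightarrow> t" by simp
  have "t - (1 / 2) ^ n \<le> real (nat \<lfloor>t * 2 ^ n\<rfloor>) * (1 / 2 ^ n)" for n
  proof -
    have "t * 2 ^ n - 1 \<le> real (nat \<lfloor>t * 2 ^ n\<rfloor>)" using assms by simp
    then have "(t * 2 ^ n - 1) * (1 / 2 ^ n) \<le> real (nat \<lfloor>t * 2 ^ n\<rfloor>) * (1 / 2 ^ n)"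
      by (intro mult_right_mono) auto
    moreover have "(t * 2 ^ n - 1) * (1 / 2 ^ n) = t - (1 / 2) ^ n"
      by (simp add: diff_divide_distrib power_one_over)
    ultimately show ?thesis by simp
  qed
  then show "\<forall>\<^sub>F n in sequentially. t - (1 / 2) ^ n \<le> real (nat \<lfloor>t * 2 ^ n\<rfloor>) * (1 / 2 ^ n)" by simp
  show "\<forall>\<^sub>F n in sequentially. real (nat \<lfloor>t * 2 ^ n\<rfloor>) * (1 / 2 ^ n) \<le> t"
    using step_count_le[OF assms] by simp
qed auto

text \<open>The bound is geometric in \<open>n\<close>, hence summable. The \<open>m\<close> double
  steps cost \<open>m * k\<^sup>2\<close> times \<open>norm (B (B x))\<close>, where
  \<open>m * (2 * k) \<le> t\<close>; rounding costs at most one step of length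
  \<open>k\<close>.\<close>

lemma E_Suc_diff:
  assumes t: "t \<ge> 0" and x: "x \<in> D" "B x \<in> D"
  shows "norm (E (Suc n) t x - E n t x) \<le> (norm (B x) + t * norm (B (B x))) * (1 / 2) ^ n"
proof -
  define k where "k = (1::real) / 2 ^ Suc n"
  have k: "k > 0" "2 * k = 1 / 2 ^ n" by (auto simp: k_def)
  define m where "m = nat \<lfloor>t * 2 ^ n\<rfloor>"
  \<comment> \<open>Doubling a number doubles its floor or gives one more; \<open>e\<close> is this
    possible extra step.\<close>
  define e where "e = nat \<lfloor>t * 2 ^ Suc n\<rfloor> - 2 * m"
  have "2 * \<lfloor>t * 2 ^ n\<rfloor> \<le> \<lfloor>t * 2 ^ Suc n\<rfloor>" "\<lfloor>t * 2 ^ Suc n\<rfloor> \<le> 2 * \<lfloor>t * 2 ^ n\<rfloor> + 1"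
    by (simp_all add: le_floor_iff floor_le_iff) linarith
  then have "nat \<lfloor>t * 2 ^ Suc n\<rfloor> = 2 * m + e" and e: "e \<le> 1"
    using t unfolding m_def e_def by auto
  then have "E (Suc n) t x = (J k ^^ (2 * m)) ((J k ^^ e) x)"
    by (simp add: E_def k_def funpow_add)
  moreover have "E n t x = (J (2 * k) ^^ m) x" by (simp add: E_def k m_def)
  ultimately have "E (Suc n) t x - E n t x =
      (J k ^^ (2 * m)) ((J k ^^ e) x - x) + ((J k ^^ (2 * m)) x - (J (2 * k) ^^ m) x)"
    by (simp add: J_pow_diff[OF k(1)])
  then have "norm (E (Suc n) t x - E n t x) \<le>
      norm ((J k ^^ (2 * m)) ((J k ^^ e) x - x)) + norm ((J k ^^ (2 * m)) x - (J (2 * k) ^^ m) x)"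
    by (simp only: norm_triangle_ineq)
  also have "\<dots> \<le> norm (B x) * (1 / 2) ^ n + (t * norm (B (B x))) * (1 / 2) ^ n"
  proof (rule add_mono)
    have "norm ((J k ^^ (2 * m)) ((J k ^^ e) x - x)) \<le> norm ((J k ^^ e) x - x)"
      by (rule J_pow_norm[OF k(1)])
    also have "\<dots> \<le> (real e * k) * norm (B x)" by (rule J_pow_step[OF k(1) x(1)])
    also have "\<dots> \<le> (1 / 2) ^ n * norm (B x)"
    proof (rule mult_right_mono)
      have "real e * k \<le> 1 * (2 * k)" using e k(1) by (intro mult_mono) auto
      then show "real e * k \<le> (1 / 2) ^ n" by (simp add: k power_one_over)
    qed simp
    finally show "norm ((J k ^^ (2 * m)) ((J k ^^ e) x - x)) \<le> norm (B x) * (1 / 2) ^ n"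
      by (simp add: mult.commute)
    have "norm ((J k ^^ (2 * m)) x - (J (2 * k) ^^ m) x) \<le> real m * (k\<^sup>2 * norm (B (B x)))"
      by (rule J_pow_halve_step[OF k(1) x])
    also have "\<dots> = (real m * (1 / 2 ^ n)) * (k / 2 * norm (B (B x)))"
      unfolding k(2)[symmetric] by (simp add: power2_eq_square)
    also have "\<dots> \<le> t * ((1 / 2) ^ n * norm (B (B x)))"
    proof (intro mult_mono t)
      show "real m * (1 / 2 ^ n) \<le> t" unfolding m_def by (rule step_count_le[OF t])
      have "k / 2 \<le> 2 * k" using k(1) by simp
      then show "k / 2 \<le> (1 / 2) ^ n" by (simp add: k power_one_over)
    qed (use k(1) in auto)
    finally show "norm ((J k ^^ (2 * m)) x - (J (2 * k) ^^ m) x) \<le>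
        (t * norm (B (B x))) * (1 / 2) ^ n"
      by (simp add: mult_ac)
  qed
  finally show ?thesis by (simp add: distrib_right)
qed

lemma J_tendsto: "(\<lambda>n. J (1 / 2 ^ n) x) \<longlonglongrightarrow> x"
proof (rule tendsto_id_on_dense[OF _ dense])
  show "\<forall>\<^sub>F n in sequentially. linear (J (1 / 2 ^ n)) \<and> (\<forall>x. norm (J (1 / 2 ^ n) x) \<le> norm x)"
    by (simp add: J_linear J_norm)
  fix x assume x: "x \<in> D"
  have "(\<lambda>n. J (1 / 2 ^ n) x - x) \<longlonglongrightarrow> 0"
  proof (rule Lim_null_comparison)
    show "\<forall>\<^sub>F n in sequentially. norm (J (1 / 2 ^ n) x - x) \<le> (1 / 2) ^ n * norm (B x)"
      using J_step[OF _ x, of "1 / 2 ^ _"] by (simp add: power_one_over)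
    show "(\<lambda>n. (1 / 2) ^ n * norm (B x)) \<longlonglongrightarrow> 0"
      by (intro tendsto_mult_left_zero LIMSEQ_power_zero) simp
  qed
  then show "(\<lambda>n. J (1 / 2 ^ n) x) \<longlonglongrightarrow> x" by (simp add: LIM_zero_iff)
qed

text \<open>The error bound involves \<open>B (B x)\<close>, so convergence is first proved on this
  set. Resolvents map \<open>D\<close> into it, since they commute with \<open>B\<close>, and they
  approximate the identity.\<close>

lemma dense_dom_square: "closure {x \<in> D. B x \<in> D} = UNIV"
proof -
  have "D \<subseteq> closure {x \<in> D. B x \<in> D}"
  proof
    fix x assume "x \<in> D"
    then have "\<forall>n. J (1 / 2 ^ n) x \<in> {x \<in> D. B x \<in> D}" by (simp add: J_dom B_J)
    then show "x \<in> closure {x \<in> D. B x \<in> D}"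
      unfolding closure_sequential by (intro exI[of _ "\<lambda>n. J (1 / 2 ^ n) x"] conjI J_tendsto)
  qed
  then have "closure D \<subseteq> closure {x \<in> D. B x \<in> D}" by (rule closure_minimal) simp
  then show ?thesis using dense by auto
qed

lemma E_convergent:
  assumes t: "t \<ge> 0"
  shows "convergent (\<lambda>n. E n t x)"
proof (rule convergent_on_dense[OF E_linear E_norm dense_dom_square])
  fix x assume x: "x \<in> {x \<in> D. B x \<in> D}"
  have "summable (\<lambda>n. E (Suc n) t x - E n t x)"
  proof (rule summable_comparison_test')
    show "summable (\<lambda>n. (norm (B x) + t * norm (B (B x))) * (1 / 2) ^ n)"
      by (intro summable_mult summable_geometric) simp
    show "norm (E (Suc n) t x - E n t x) \<le> (norm (B x) + t * norm (B (B x))) * (1 / 2) ^ n" for n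
      using E_Suc_diff[OF t] x by blast
  qed
  then have "convergent (\<lambda>n. \<Sum>i<n. E (Suc i) t x - E i t x)"
    by (simp add: summable_iff_convergent)
  then have "convergent (\<lambda>n. E n t x - E 0 t x)"
    by (simp only: sum_lessThan_telescope[of "\<lambda>i. E i t x"])
  then have "convergent (\<lambda>n. (E n t x - E 0 t x) + E 0 t x)"
    by (intro convergent_add convergent_const)
  then show "convergent (\<lambda>n. E n t x)" by simp
qed

section \<open>The limit semigroup\<close>

definition T :: "real \<Rightarrow> 'v \<Rightarrow> 'v"
  where "T t x = lim (\<lambda>n. E n t x)"

lemma E_tendsto: "t \<ge> 0 \<Longrightarrow> (\<lambda>n. E n t x) \<longlonglongrightarrow> T t x"
  unfolding T_def using E_convergent convergent_LIMSEQ_iff by blast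

lemma T_norm: "t \<ge> 0 \<Longrightarrow> norm (T t x) \<le> norm x"
  by (rule LIMSEQ_le_const2[OF tendsto_norm[OF E_tendsto]]) (auto simp: E_norm)

lemma T_linear:
  assumes t: "t \<ge> 0"
  shows "linear (T t)"
proof (rule linearI)
  fix x y c
  have "(\<lambda>n. E n t (x + y)) \<longlonglongrightarrow> T t x + T t y"
    using tendsto_add[OF E_tendsto[OF t] E_tendsto[OF t]] by (simp add: linear_add[OF E_linear])
  then show "T t (x + y) = T t x + T t y" using LIMSEQ_unique E_tendsto[OF t] by blast
  have "(\<lambda>n. E n t (c *\<^sub>R x)) \<longlonglongrightarrow> c *\<^sub>R T t x"
    using tendsto_scaleR[OF tendsto_const E_tendsto[OF t]] by (simp add: linear_scale[OF E_linear])
  then show "T t (c *\<^sub>R x) = c *\<^sub>R T t x" using LIMSEQ_unique E_tendsto[OF t] by blast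
qed

lemma T_bounded_linear: "t \<ge> 0 \<Longrightarrow> bounded_linear (T t)"
  using T_linear T_norm by (intro bounded_linear_intro[of _ 1]) (auto simp: linear_add linear_scale)

text \<open>The construction is only real linear; with \<open>L = smul c\<close> this gives
  linearity over the scalar field.\<close>

lemma T_commute:
  assumes L: "bounded_linear L" "\<And>u. u \<in> D \<Longrightarrow> L u \<in> D" "\<And>u. u \<in> D \<Longrightarrow> B (L u) = L (B u)"
    and t: "t \<ge> 0"
  shows "T t (L x) = L (T t x)"
proof -
  interpret L: bounded_linear L by fact
  have J: "J h (L y) = L (J h y)" if h: "h > 0" for h y
  proof (rule J_eq[OF h])
    have "L (J h y) - h *\<^sub>R B (L (J h y)) = L (J h y - h *\<^sub>R B (J h y))"
      using L(3) J_dom[OF h] by (simp add: L.diff L.scaleR)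
    then show "L (J h y) - h *\<^sub>R B (L (J h y)) = L y" using J_inverse[OF h] by simp
  qed (use L J_dom[OF h] in blast)
  have "(J h ^^ m) (L y) = L ((J h ^^ m) y)" if "h > 0" for h m y
    by (induction m) (simp_all add: J that)
  then have "E n t (L x) = L (E n t x)" for n by (simp add: E_def)
  then have "(\<lambda>n. E n t (L x)) \<longlonglongrightarrow> L (T t x)" using L.tendsto[OF E_tendsto[OF t]] by simp
  then show ?thesis using LIMSEQ_unique E_tendsto[OF t] by blast
qed

lemma T_0: "T 0 x = x"
  by (simp add: T_def E_def)

text \<open>Rounding \<open>s\<close> and \<open>t\<close> separately loses at most one step
  compared with rounding \<open>s + t\<close>.\<close>

lemma E_add_diff:
  assumes "s \<ge> 0" "t \<ge> 0"
  shows "norm (E n (s + t) x - E n s (E n t x)) \<le> norm (J (1 / 2 ^ n) x - x)"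
proof -
  define a where "a = nat \<lfloor>s * 2 ^ n\<rfloor>"
  define b where "b = nat \<lfloor>t * 2 ^ n\<rfloor>"
  define e where "e = nat \<lfloor>(s + t) * 2 ^ n\<rfloor> - (a + b)"
  have "\<lfloor>s * 2 ^ n\<rfloor> + \<lfloor>t * 2 ^ n\<rfloor> \<le> \<lfloor>(s + t) * 2 ^ n\<rfloor>"
    "\<lfloor>(s + t) * 2 ^ n\<rfloor> \<le> \<lfloor>s * 2 ^ n\<rfloor> + \<lfloor>t * 2 ^ n\<rfloor> + 1"
    by (simp_all add: le_floor_iff floor_le_iff distrib_right) linarith+
  moreover have "\<lfloor>s * 2 ^ n\<rfloor> \<ge> 0" "\<lfloor>t * 2 ^ n\<rfloor> \<ge> 0" using assms by auto
  ultimately have "nat \<lfloor>(s + t) * 2 ^ n\<rfloor> = a + b + e" and e: "e = 0 \<or> e = 1"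
    unfolding a_def b_def e_def by linarith+
  let ?J = "J (1 / 2 ^ n)"
  have "E n (s + t) x - E n s (E n t x) = (?J ^^ (a + b)) ((?J ^^ e) x - x)"
    using \<open>nat \<lfloor>(s + t) * 2 ^ n\<rfloor> = a + b + e\<close>
    by (simp add: E_def a_def b_def J_pow_diff funpow_add)
  also have "norm \<dots> \<le> norm ((?J ^^ e) x - x)" by (rule J_pow_norm) simp
  also have "\<dots> \<le> norm (?J x - x)" using e by auto
  finally show ?thesis .
qed

lemma T_add:
  assumes st: "s \<ge> 0" "t \<ge> 0"
  shows "T (s + t) x = T s (T t x)"
proof -
  have "(\<lambda>n. E n (s + t) x - E n s (E n t x)) \<longlonglongrightarrow> 0"
  proof (rule Lim_null_comparison)
    show "\<forall>\<^sub>F n in sequentially.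
        norm (E n (s + t) x - E n s (E n t x)) \<le> norm (J (1 / 2 ^ n) x - x)"
      using E_add_diff[OF st] by simp
    show "(\<lambda>n. norm (J (1 / 2 ^ n) x - x)) \<longlonglongrightarrow> 0"
      using J_tendsto[of x] by (simp add: LIM_zero tendsto_norm_zero)
  qed
  \<comment> \<open>The bound on \<open>E n s\<close> is uniform in \<open>n\<close>, so the inner
    iterate may be replaced by its limit.\<close>
  moreover have "(\<lambda>n. E n s (E n t x - T t x)) \<longlonglongrightarrow> 0"
  proof (rule Lim_null_comparison)
    show "\<forall>\<^sub>F n in sequentially. norm (E n s (E n t x - T t x)) \<le> norm (E n t x - T t x)"
      by (simp add: E_norm)
    show "(\<lambda>n. norm (E n t x - T t x)) \<longlonglongrightarrow> 0"
      using E_tendsto[OF st(2), of x] by (simp add: LIM_zero tendsto_norm_zero)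
  qed
  ultimately have "(\<lambda>n. (E n (s + t) x - E n s (E n t x)) + E n s (E n t x - T t x) + E n s (T t x))
      \<longlonglongrightarrow> 0 + 0 + T s (T t x)"
    by (intro tendsto_add E_tendsto st)
  then have "(\<lambda>n. E n (s + t) x) \<longlonglongrightarrow> T s (T t x)"
    by (simp add: linear_diff[OF E_linear])
  then show ?thesis using LIMSEQ_unique E_tendsto[of "s + t"] st by (metis add_nonneg_nonneg)
qed

section \<open>First-order expansion and the generator\<close>

lemma J_pow_expansion:
  assumes h: "h > 0" and x: "x \<in> D" and le: "\<And>j. j \<le> m \<Longrightarrow> norm ((J h ^^ j) (B x) - B x) \<le> d"
  shows "norm ((J h ^^ m) x - x - (real m * h) *\<^sub>R B x) \<le> real m * h * d"
  using le
proof (induction m)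
  case (Suc m)
  \<comment> \<open>Each increment is \<open>h\<close> times an iterate of \<open>B x\<close>, which
    \<open>le\<close> keeps within \<open>d\<close> of \<open>B x\<close>.\<close>
  have "(J h ^^ Suc m) x - (J h ^^ m) x = (J h ^^ m) (h *\<^sub>R J h (B x))"
    by (simp add: J_pow_diff[OF h, symmetric] J_diff_eq[OF h x] funpow_Suc_right del: funpow.simps)
  also have "\<dots> = h *\<^sub>R (J h ^^ Suc m) (B x)"
    by (simp add: linear_scale[OF linear_funpow[OF J_linear[OF h]]] funpow_Suc_right del: funpow.simps)
  finally have "(J h ^^ Suc m) x - x - (real (Suc m) * h) *\<^sub>R B x =
      ((J h ^^ m) x - x - (real m * h) *\<^sub>R B x) + h *\<^sub>R ((J h ^^ Suc m) (B x) - B x)"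
    by (simp add: algebra_simps del: funpow.simps)
  then have "norm ((J h ^^ Suc m) x - x - (real (Suc m) * h) *\<^sub>R B x) \<le>
      norm ((J h ^^ m) x - x - (real m * h) *\<^sub>R B x) + norm (h *\<^sub>R ((J h ^^ Suc m) (B x) - B x))"
    by (simp only: norm_triangle_ineq)
  also have "\<dots> \<le> real m * h * d + h * d"
  proof (rule add_mono)
    have "norm ((J h ^^ Suc m) (B x) - B x) \<le> d" by (rule Suc.prems) simp
    then show "norm (h *\<^sub>R ((J h ^^ Suc m) (B x) - B x)) \<le> h * d"
      using h by (simp del: funpow.simps)
  qed (use Suc in simp)
  finally show ?case by (simp add: algebra_simps del: funpow.simps)
qed simp

text \<open>The rate in \<open>J_pow_step\<close> holds on \<open>D\<close>, where
  \<open>B x\<close> need not lie, so \<open>B x\<close> is replaced by a nearby \<open>y\<close> in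
  \<open>D\<close>. The replacement is paid for twice, once inside the iterate and once outside,
  whence the factor 2.\<close>

lemma T_expansion:
  assumes t: "t \<ge> 0" and x: "x \<in> D" and y: "y \<in> D"
  shows "norm (T t x - x - t *\<^sub>R B x) \<le> t * (2 * norm (B x - y) + t * norm (B y))"
proof (rule LIMSEQ_le_const2)
  let ?m = "\<lambda>n. nat \<lfloor>t * 2 ^ n\<rfloor>" and ?h = "\<lambda>n. (1::real) / 2 ^ n"
  show "(\<lambda>n. norm (E n t x - x - (real (?m n) * ?h n) *\<^sub>R B x)) \<longlonglongrightarrow>
      norm (T t x - x - t *\<^sub>R B x)"
    by (intro tendsto_intros E_tendsto step_count_tendsto t)
  have "norm (E n t x - x - (real (?m n) * ?h n) *\<^sub>R B x) \<le>
      t * (2 * norm (B x - y) + t * norm (B y))" for n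
  proof -
    let ?d = "2 * norm (B x - y) + t * norm (B y)"
    have h: "?h n > 0" by simp
    have "norm ((J (?h n) ^^ j) (B x) - B x) \<le> ?d" if j: "j \<le> ?m n" for j
    proof -
      have "(J (?h n) ^^ j) (B x) - B x =
          (J (?h n) ^^ j) (B x - y) + ((J (?h n) ^^ j) y - y) - (B x - y)"
        by (simp add: J_pow_diff[OF h])
      then have "norm ((J (?h n) ^^ j) (B x) - B x) \<le>
          norm ((J (?h n) ^^ j) (B x - y)) + norm ((J (?h n) ^^ j) y - y) + norm (B x - y)"
        by (simp only: norm_add_diff_le)
      moreover have "norm ((J (?h n) ^^ j) (B x - y)) \<le> norm (B x - y)"
        by (rule J_pow_norm[OF h])
      moreover have "norm ((J (?h n) ^^ j) y - y) \<le> t * norm (B y)"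
      proof -
        have "real j * ?h n \<le> real (?m n) * ?h n" using j by (intro mult_right_mono) auto
        also have "\<dots> \<le> t" by (rule step_count_le[OF t])
        finally have "real j * ?h n * norm (B y) \<le> t * norm (B y)" by (intro mult_right_mono) auto
        then show ?thesis using J_pow_step[OF h y, of j] by linarith
      qed
      ultimately show ?thesis by linarith
    qed
    then have "norm (E n t x - x - (real (?m n) * ?h n) *\<^sub>R B x) \<le> real (?m n) * ?h n * ?d"
      unfolding E_def by (rule J_pow_expansion[OF h x])
    also have "\<dots> \<le> t * ?d"
      using step_count_le[OF t, of n] t by (intro mult_right_mono) auto
    finally show ?thesis .
  qed
  then show "\<exists>N. \<forall>n\<ge>N. norm (E n t x - x - (real (?m n) * ?h n) *\<^sub>R B x) \<le>
      t * (2 * norm (B x - y) + t * norm (B y))"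
    by blast
qed

lemma T_tendsto_id: "((\<lambda>t. T t x) \<longlongrightarrow> x) (at_right 0)"
proof (rule tendsto_id_on_dense[OF _ dense])
  show "\<forall>\<^sub>F t in at_right 0. linear (T t) \<and> (\<forall>x. norm (T t x) \<le> norm x)"
    using eventually_at_right_less[of 0]
    by eventually_elim (simp add: T_linear T_norm)
  fix x assume x: "x \<in> D"
  have "((\<lambda>t. T t x - x - t *\<^sub>R B x) \<longlongrightarrow> 0) (at_right 0)"
  proof (rule Lim_null_comparison)
    show "\<forall>\<^sub>F t in at_right 0. norm (T t x - x - t *\<^sub>R B x) \<le> t * (2 * norm (B x - x) + t * norm (B x))"
      using eventually_at_right_less[of 0]
      by eventually_elim (rule T_expansion[OF _ x x], simp)
    have "((\<lambda>t. t * (2 * norm (B x - x) + t * norm (B x))) \<longlongrightarrow>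
        0 * (2 * norm (B x - x) + 0 * norm (B x))) (at_right 0)"
      by (intro tendsto_intros)
    then show "((\<lambda>t. t * (2 * norm (B x - x) + t * norm (B x))) \<longlongrightarrow> 0) (at_right 0)" by simp
  qed
  then have "((\<lambda>t. (T t x - x - t *\<^sub>R B x) + x + t *\<^sub>R B x) \<longlongrightarrow> 0 + x + 0 *\<^sub>R B x) (at_right 0)"
    by (intro tendsto_intros)
  then show "((\<lambda>t. T t x) \<longlongrightarrow> x) (at_right 0)" by simp
qed

lemma T_derivative:
  assumes x: "x \<in> D"
  shows "((\<lambda>t. (1 / t) *\<^sub>R (T t x - x)) \<longlongrightarrow> B x) (at_right 0)"
proof (rule tendstoI)
  fix e :: real assume e: "e > 0"
  then obtain y where y: "y \<in> D" "norm (B x - y) < e / 4"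
    using dense_approx[OF dense, of "e / 4"] by auto
  have "((\<lambda>t. t * norm (B y)) \<longlongrightarrow> 0 * norm (B y)) (at_right 0)" by (intro tendsto_intros)
  then have "\<forall>\<^sub>F t in at_right 0. t * norm (B y) < e / 2"
    using e by (intro order_tendstoD(2)) auto
  with eventually_at_right_less[of 0]
  show "\<forall>\<^sub>F t in at_right 0. dist ((1 / t) *\<^sub>R (T t x - x)) (B x) < e"
  proof eventually_elim
    case (elim t)
    have "(1 / t) *\<^sub>R (T t x - x) - B x = (1 / t) *\<^sub>R (T t x - x - t *\<^sub>R B x)"
      using elim by (simp add: scaleR_diff_right)
    then have "norm ((1 / t) *\<^sub>R (T t x - x) - B x) = norm (T t x - x - t *\<^sub>R B x) / t"
      using elim by simp
    also have "\<dots> \<le> 2 * norm (B x - y) + t * norm (B y)"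
      using T_expansion[OF _ x y(1), of t] elim by (simp add: divide_le_eq mult.commute)
    also have "\<dots> < e" using y(2) elim by linarith
    finally show ?case by (simp add: dist_norm)
  qed
qed

text \<open>The vector \<open>x - (1 / t) *\<^sub>R (T t x - x)\<close> is
  \<open>(1 + 1 / t) *\<^sub>R x\<close> minus a vector of norm at most \<open>norm x / t\<close>.
  No membership in \<open>D\<close> enters, so the estimate covers the whole domain of the
  generator.\<close>

lemma T_quotient_dissipative:
  assumes "((\<lambda>t. (1 / t) *\<^sub>R (T t x - x)) \<longlongrightarrow> y) (at_right 0)"
  shows "norm x \<le> norm (x - y)"
proof (rule tendsto_lowerbound)
  show "((\<lambda>t. norm (x - (1 / t) *\<^sub>R (T t x - x))) \<longlongrightarrow> norm (x - y)) (at_right 0)"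
    by (intro tendsto_intros assms)
  show "\<forall>\<^sub>F t in at_right 0. norm x \<le> norm (x - (1 / t) *\<^sub>R (T t x - x))"
    using eventually_at_right_less[of 0]
  proof eventually_elim
    case (elim t)
    have "x - (1 / t) *\<^sub>R (T t x - x) = (1 + 1 / t) *\<^sub>R x - (1 / t) *\<^sub>R T t x"
      by (simp add: algebra_simps)
    then have "norm (x - (1 / t) *\<^sub>R (T t x - x)) \<ge> norm ((1 + 1 / t) *\<^sub>R x) - norm ((1 / t) *\<^sub>R T t x)"
      using norm_triangle_ineq2 by metis
    moreover have "norm ((1 + 1 / t) *\<^sub>R x) = norm x + (1 / t) * norm x"
      using elim by (simp add: distrib_right)
    moreover have "norm ((1 / t) *\<^sub>R T t x) \<le> (1 / t) * norm x"
      using elim T_norm[of t x] by (simp add: divide_right_mono)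
    ultimately show ?case by linarith
  qed
qed simp

text \<open>The generator extends \<open>B\<close>. It cannot be larger: 1 - B is already onto, and
  1 minus the generator is injective by \<open>T_quotient_dissipative\<close>.\<close>

lemma T_generator: "generator_of (D, B) T"
  unfolding generator_of_def
proof (intro conjI)
  have "x \<in> D" if lim: "((\<lambda>t. (1 / t) *\<^sub>R (T t x - x)) \<longlongrightarrow> y) (at_right 0)" for x y
  proof -
    obtain u where u: "u \<in> D" "u - B u = x - y" using range[of 1 "x - y"] by auto
    have "((\<lambda>t. (1 / t) *\<^sub>R (T t x - x) - (1 / t) *\<^sub>R (T t u - u)) \<longlongrightarrow> y - B u) (at_right 0)"
      by (intro tendsto_diff lim T_derivative u)
    moreover have "\<forall>\<^sub>F t in at_right 0. (1 / t) *\<^sub>R (T t x - x) - (1 / t) *\<^sub>R (T t u - u) =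
        (1 / t) *\<^sub>R (T t (x - u) - (x - u))"
      using eventually_at_right_less[of 0]
      by eventually_elim (simp add: linear_diff[OF T_linear] algebra_simps)
    ultimately have "((\<lambda>t. (1 / t) *\<^sub>R (T t (x - u) - (x - u))) \<longlongrightarrow> y - B u) (at_right 0)"
      by (rule Lim_transform_eventually)
    then have "norm (x - u) \<le> norm ((x - u) - (y - B u))" by (rule T_quotient_dissipative)
    moreover have "(x - u) - (y - B u) = 0" using u(2) by (simp add: algebra_simps)
    ultimately show ?thesis using u(1) by simp
  qed
  then show "op_dom (D, B) = {x. \<exists>y. ((\<lambda>t. (1 / t) *\<^sub>R (T t x - x)) \<longlongrightarrow> y) (at_right 0)}"
    using T_derivative by auto
  show "\<forall>x\<in>op_dom (D, B). ((\<lambda>t. (1 / t) *\<^sub>R (T t x - x)) \<longlongrightarrow> op_app (D, B) x) (at_right 0)"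
    using T_derivative by simp
qed

end

section \<open>Boundary quadruples\<close>

lemma to_complex_diff:
  fixes x y :: "'k::real_or_complex"
  shows "to_complex (x - y) = to_complex x - to_complex y"
  using to_complex_add[of "x - y" y] by simp

lemma to_complex_0: "to_complex (0 :: 'k::real_or_complex) = 0"
  using to_complex_diff[of "0 :: 'k" 0] by simp

lemma to_complex_minus:
  fixes x :: "'k::real_or_complex"
  shows "to_complex (- x) = - to_complex x"
  using to_complex_diff[of 0 x] by (simp add: to_complex_0)

lemma to_complex_inject:
  fixes x y :: "'k::real_or_complex"
  shows "to_complex x = to_complex y \<longleftrightarrow> x = y"
  using norm_to_complex[of "x - y"] by (auto simp: to_complex_diff)

lemma to_complex_1: "to_complex (1 :: 'k::real_or_complex) = 1"
  using to_complex_mult[of "1 :: 'k" 1] to_complex_inject[of "1 :: 'k" 0] by (simp add: to_complex_0)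

lemma to_complex_of_real: "to_complex (of_real t :: 'k::real_or_complex) = of_real t"
  by (simp add: of_real_def to_complex_scaleR to_complex_1)

lemma norm_rc_conj:
  fixes x :: "'k::real_or_complex"
  shows "norm (rc_conj x) = norm x"
  using norm_to_complex[of "rc_conj x"] by (simp add: to_complex_conj norm_to_complex)

definition re_form :: "('v \<Rightarrow> 'v \<Rightarrow> 'k::real_or_complex) \<Rightarrow> 'v \<Rightarrow> 'v \<Rightarrow> real"
  where "re_form ip x y = Re (to_complex (ip x y))"

context pre_hilbert
begin

lemma inner_form: "inner_form (re_form ip)"
proof
  fix x y z :: 'v and c :: real
  show "re_form ip (x + y) z = re_form ip x z + re_form ip y z"
    by (simp add: re_form_def ip_add_left to_complex_add)
  show "re_form ip (c *\<^sub>R x) z = c * re_form ip x z"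
    by (simp add: re_form_def scale_of_real[symmetric] ip_scale_left to_complex_mult to_complex_of_real)
  show "re_form ip x y = re_form ip y x"
    by (simp add: re_form_def ip_conj_sym[of y x] to_complex_conj)
  show "re_form ip x x = (norm x)\<^sup>2"
    by (simp add: re_form_def ip_norm to_complex_of_real del: of_real_power)
qed

lemma norm_scale: "norm (smul c x) = norm c * norm x"
proof -
  have "norm (ip (smul c x) (smul c x)) = norm c * norm (rc_conj (c * ip x x))"
    by (simp add: ip_scale_left ip_conj_sym[of x "smul c x"] norm_mult)
  then have "(norm (smul c x))\<^sup>2 = (norm c * norm x)\<^sup>2"
    by (simp add: norm_rc_conj ip_norm norm_mult power_mult_distrib power2_eq_square del: of_real_power)
  then show ?thesis by simp
qed

lemma bounded_linear_scale: "bounded_linear (smul c)"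
proof (rule bounded_linear_intro[of _ "norm c"])
  show "smul c (t *\<^sub>R x) = t *\<^sub>R smul c x" for t x
    by (simp add: scale_of_real[symmetric] mult.commute)
qed (simp_all add: scale_right_distrib norm_scale mult.commute)

lemma real_subspace:
  assumes "module.subspace smul S"
  shows "real_vector.subspace S"
  using assms unfolding subspace_def real_vector.subspace_def by (metis scale_of_real)

lemma ip_minus_right: "ip x (- y) = - ip x y"
proof -
  have "ip (- y) x = - ip y x" using ip_scale_left[of "- 1" y x] by simp
  then have "to_complex (ip x (- y)) = - to_complex (ip x y)"
    by (simp add: ip_conj_sym[of x y] ip_conj_sym[of x "- y"] to_complex_conj to_complex_minus)
  then show ?thesis by (simp add: to_complex_minus[symmetric] to_complex_inject)
qed

text \<open>A scalar \<open>z\<close> vanishes if \<open>Re (c z) = 0\<close> for all \<open>c\<close>, so over a \<open>K\<close>-linear domain the adjoint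
  is determined by the real part of the inner product.\<close>

lemma adjoint_relation_re:
  assumes A: "operator_on smul A"
  shows "(\<forall>u\<in>op_dom A. re_form ip (op_app A u) v + re_form ip u w = 0) \<longleftrightarrow>
    (\<forall>u\<in>op_dom A. ip (op_app A u) v + ip u w = 0)" (is "?re \<longleftrightarrow> ?ip")
proof
  assume re: ?re
  show ?ip
  proof
    fix u assume u: "u \<in> op_dom A"
    let ?z = "ip (op_app A u) v + ip u w" and ?s = "smul (rc_conj (ip (op_app A u) v + ip u w))"
    have "?s u \<in> op_dom A" "op_app A (?s u) = ?s (op_app A u)"
      using A u by (auto simp: operator_on_def linear_on_def subspace_scale)
    then have "Re (to_complex (ip (?s (op_app A u)) v)) + Re (to_complex (ip (?s u) w)) = 0"
      using re unfolding re_form_def by metis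
    then have "Re (to_complex (rc_conj ?z * ?z)) = 0"
      by (simp only: ip_scale_left distrib_left to_complex_add plus_complex.sel)
    then have "Re (cnj (to_complex ?z) * to_complex ?z) = 0"
      by (simp only: to_complex_mult to_complex_conj)
    then have "(norm (to_complex ?z))\<^sup>2 = 0"
      by (simp add: cmod_power2 power2_eq_square complex_eq_iff)
    then show "?z = 0" by (simp add: norm_to_complex)
  qed
next
  assume ip: ?ip
  show ?re
  proof
    fix u assume "u \<in> op_dom A"
    then have "to_complex (ip (op_app A u) v + ip u w) = 0" using ip by (simp add: to_complex_0)
    then show "re_form ip (op_app A u) v + re_form ip u w = 0"
      by (simp add: re_form_def to_complex_add flip: plus_complex.sel)
  qed
qed

text \<open>Density makes the vector in \<open>adjoint_op\<close> unique, because the vectors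
  orthogonal to a fixed one form a closed set; the definite description then denotes it.\<close>

lemma neg_adjoint_iff:
  assumes A: "operator_on smul A" "densely_defined A"
  shows "(\<forall>u\<in>op_dom A. re_form ip (op_app A u) v + re_form ip u w = 0) \<longleftrightarrow>
    v \<in> op_dom (neg_op (adjoint_op ip A)) \<and> op_app (neg_op (adjoint_op ip A)) v = w"
proof -
  interpret re: inner_form "re_form ip" by (rule inner_form)
  let ?P = "\<lambda>w. \<forall>u\<in>op_dom A. ip (op_app A u) v = ip u w"
  have P_re: "?P (- w) \<longleftrightarrow> (\<forall>u\<in>op_dom A. re_form ip (op_app A u) v + re_form ip u w = 0)" for w
    unfolding adjoint_relation_re[OF A(1)] by (simp add: ip_minus_right eq_neg_iff_add_eq_0)
  have unique: "w = w'" if "?P w" "?P w'" for w w'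
  proof -
    have "re_form ip u (w - w') = 0" if "u \<in> op_dom A" for u
    proof -
      have "ip u w = ip u w'" using \<open>?P w\<close> \<open>?P w'\<close> that by metis
      then show ?thesis by (simp add: re.diff_right) (simp add: re_form_def)
    qed
    then have "op_dom A \<subseteq> {u. re_form ip u (w - w') = 0}" by blast
    moreover have "closed {u. re_form ip u (w - w') = 0}"
      by (intro closed_Collect_eq continuous_intros re.continuous_on)
    ultimately have "closure (op_dom A) \<subseteq> {u. re_form ip u (w - w') = 0}"
      by (rule closure_minimal)
    then have "re_form ip (w - w') (w - w') = 0"
      using A(2) by (auto simp: densely_defined_def)
    then show "w = w'" by (simp add: re.norm_sq)
  qed
  have the: "(THE w. ?P w) = w" if "?P w" for w
    using that unique by (intro the_equality) auto
  have "?P (- w) \<longleftrightarrow> (\<exists>w. ?P w) \<and> - (THE w. ?P w) = w" for w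
  proof
    assume "?P (- w)"
    then show "(\<exists>w. ?P w) \<and> - (THE w. ?P w) = w" using the[of "- w"] by auto
  next
    assume "(\<exists>w. ?P w) \<and> - (THE w. ?P w) = w"
    then obtain w' where w': "?P w'" "- (THE w. ?P w) = w" by blast
    then have "- w = w'" using the[OF w'(1)] by auto
    then show "?P (- w)" using w'(1) by simp
  qed
  then show ?thesis
    unfolding P_re[symmetric] by (simp add: neg_op_def adjoint_op_def)
qed

end

section \<open>From boundary quadruples to real boundary forms\<close>

lemma linear_on_real:
  assumes "pre_hilbert s1 ip1" "pre_hilbert s2 ip2" "linear_on s1 s2 D f"
  shows "linear_on scaleR scaleR D f"
  using assms(3) pre_hilbert.scale_of_real[OF assms(1)] pre_hilbert.scale_of_real[OF assms(2)]
  unfolding linear_on_def by metis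

lemma boundary_form_of_quadruple:
  fixes smul :: "'k::real_or_complex \<Rightarrow> 'v::banach \<Rightarrow> 'v"
  assumes hilbert: "pre_hilbert smul ip"
    and A0: "operator_on smul A\<^sub>0" "densely_defined A\<^sub>0" "skew_symmetric ip A\<^sub>0"
    and A_def: "A = neg_op (adjoint_op ip A\<^sub>0)"
    and quadruple: "boundary_quadruple ip smul A\<^sub>0 smul\<^sub>m ip\<^sub>m smul\<^sub>p ip\<^sub>p G\<^sub>m G\<^sub>p"
  shows "boundary_form (re_form ip) (re_form ip\<^sub>m) (re_form ip\<^sub>p) (op_dom A\<^sub>0) (op_dom A) (op_app A) G\<^sub>m G\<^sub>p"
proof -
  interpret H: pre_hilbert smul ip by (rule hilbert)
  have m: "pre_hilbert smul\<^sub>m ip\<^sub>m" and p: "pre_hilbert smul\<^sub>p ip\<^sub>p"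
    and lin: "linear_on smul smul\<^sub>m (op_dom A) G\<^sub>m" "linear_on smul smul\<^sub>p (op_dom A) G\<^sub>p"
    and onto: "G\<^sub>m ` op_dom A = UNIV" "G\<^sub>p ` op_dom A = UNIV"
    and green: "\<And>u v. u \<in> op_dom A \<Longrightarrow> v \<in> op_dom A \<Longrightarrow>
      ip (op_app A u) v + ip u (op_app A v) = ip\<^sub>p (G\<^sub>p u) (G\<^sub>p v) - ip\<^sub>m (G\<^sub>m u) (G\<^sub>m v)"
    and kernels: "{x + y | x y. x \<in> op_dom A \<and> G\<^sub>m x = 0 \<and> y \<in> op_dom A \<and> G\<^sub>p y = 0} = op_dom A"
    using quadruple unfolding boundary_quadruple_def Let_def A_def[symmetric] by auto
  interpret V: inner_form "re_form ip" by (rule H.inner_form)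
  interpret M: inner_form "re_form ip\<^sub>m" by (rule pre_hilbert.inner_form[OF m])
  interpret P: inner_form "re_form ip\<^sub>p" by (rule pre_hilbert.inner_form[OF p])
  have adj: "(\<forall>u\<in>op_dom A\<^sub>0. re_form ip (op_app A\<^sub>0 u) v + re_form ip u w = 0) \<longleftrightarrow>
      v \<in> op_dom A \<and> op_app A v = w" for v w
    unfolding A_def by (rule H.neg_adjoint_iff[OF A0(1,2)])
  have A0_A: "v \<in> op_dom A \<and> op_app A v = op_app A\<^sub>0 v" if "v \<in> op_dom A\<^sub>0" for v
    unfolding adj[symmetric] H.adjoint_relation_re[OF A0(1)]
    using A0(3) that unfolding skew_symmetric_def by blast
  have add: "x + y \<in> op_dom A \<and> op_app A (x + y) = op_app A x + op_app A y"
    if "x \<in> op_dom A" "y \<in> op_dom A" for x y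
    unfolding adj[symmetric] V.add_right
    using adj[of x "op_app A x"] adj[of y "op_app A y"] that by force
  have scale: "c *\<^sub>R x \<in> op_dom A \<and> op_app A (c *\<^sub>R x) = c *\<^sub>R op_app A x"
    if "x \<in> op_dom A" for c x
    unfolding adj[symmetric] V.scaleR_right distrib_left[symmetric]
    using adj[of x "op_app A x"] that by simp
  have zero: "0 \<in> op_dom A" using adj[of 0 0] by (simp add: V.zero_right)
  have Gm: "linear_on scaleR scaleR (op_dom A) G\<^sub>m" by (rule linear_on_real[OF hilbert m lin(1)])
  have Gp: "linear_on scaleR scaleR (op_dom A) G\<^sub>p" by (rule linear_on_real[OF hilbert p lin(2)])
  show ?thesis
  proof
    show "subspace (op_dom A)" using zero add scale by (auto intro!: subspaceI)
    show "op_dom A\<^sub>0 \<subseteq> op_dom A" using A0_A by blast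
    show "linear_on scaleR scaleR (op_dom A) (op_app A)"
      using add scale by (auto simp: linear_on_def)
    show "(\<forall>u\<in>op_dom A\<^sub>0. re_form ip (op_app A u) v + re_form ip u w = 0) \<longleftrightarrow>
        v \<in> op_dom A \<and> op_app A v = w" for v w
      unfolding adj[symmetric] using A0_A by simp
    fix u v assume uv: "u \<in> op_dom A" "v \<in> op_dom A"
    show "re_form ip (op_app A u) v + re_form ip u (op_app A v) =
        re_form ip\<^sub>p (G\<^sub>p u) (G\<^sub>p v) - re_form ip\<^sub>m (G\<^sub>m u) (G\<^sub>m v)"
      using arg_cong[OF green[OF uv], of "\<lambda>z. Re (to_complex z)"]
      by (simp add: re_form_def to_complex_add to_complex_diff)
  next
    fix x y
    obtain a where a: "a \<in> op_dom A" "G\<^sub>m a = x" using onto(1) by (metis UNIV_I imageE)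
    obtain b where b: "b \<in> op_dom A" "G\<^sub>p b = y" using onto(2) by (metis UNIV_I imageE)
    obtain a1 a2 where a12: "a = a1 + a2" "a1 \<in> op_dom A" "G\<^sub>m a1 = 0" "a2 \<in> op_dom A" "G\<^sub>p a2 = 0"
      using a(1) kernels by blast
    obtain b1 b2 where b12: "b = b1 + b2" "b1 \<in> op_dom A" "G\<^sub>m b1 = 0" "b2 \<in> op_dom A" "G\<^sub>p b2 = 0"
      using b(1) kernels by blast
    \<comment> \<open>The summand \<open>a2\<close> keeps the minus trace of \<open>a\<close> and
      has plus trace zero; \<open>b1\<close> keeps the plus trace of \<open>b\<close> and has minus
      trace zero.\<close>
    have "G\<^sub>m (a2 + b1) = x" "G\<^sub>p (a2 + b1) = y"
      using Gm Gp a b a12 b12 by (auto simp: linear_on_def)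
    then show "\<exists>w\<in>op_dom A. G\<^sub>m w = x \<and> G\<^sub>p w = y" using add a12(4) b12(2) by blast
  qed (use Gm Gp in auto)
qed

theorem (in m_dissipative) generates_contraction_semigroup:
  assumes "pre_hilbert smul ip" "operator_on smul (D, B)"
  shows "generates_contraction_semigroup smul (D, B)"
proof -
  interpret H: pre_hilbert smul ip by fact
  have "T t (smul c x) = smul c (T t x)" if "t \<ge> 0" for t c x
    using assms(2) that
    by (intro T_commute H.bounded_linear_scale)
      (auto simp: operator_on_def linear_on_def H.subspace_scale)
  then have "Vector_Spaces.linear smul smul (T t)" if "t \<ge> 0" for t
    using that H.vector_space_axioms by (simp add: Vector_Spaces.linear_iff linear_add[OF T_linear])
  then have "C0_semigroup smul T"
    by (simp add: C0_semigroup_def T_bounded_linear T_0 T_add T_tendsto_id)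
  then show ?thesis
    unfolding generates_contraction_semigroup_def using T_norm T_generator by blast
qed

theorem theorem1p1:
  fixes smul :: "'k::real_or_complex \<Rightarrow> 'v::banach \<Rightarrow> 'v"
    and ip :: "'v \<Rightarrow> 'v \<Rightarrow> 'k"
    and A\<^sub>0 A B :: "'v partial_map"
    and smul\<^sub>m :: "'k \<Rightarrow> 'm::real_normed_vector \<Rightarrow> 'm" and ip\<^sub>m :: "'m \<Rightarrow> 'm \<Rightarrow> 'k"
    and smul\<^sub>p :: "'k \<Rightarrow> 'p::real_normed_vector \<Rightarrow> 'p" and ip\<^sub>p :: "'p \<Rightarrow> 'p \<Rightarrow> 'k"
    and G\<^sub>m :: "'v \<Rightarrow> 'm" and G\<^sub>p :: "'v \<Rightarrow> 'p"
  assumes hilbert: "pre_hilbert smul ip"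
    and A0: "operator_on smul A\<^sub>0" "densely_defined A\<^sub>0" "skew_symmetric ip A\<^sub>0"
    and A_def: "A = neg_op (adjoint_op ip A\<^sub>0)"
    and quadruple: "boundary_quadruple ip smul A\<^sub>0 smul\<^sub>m ip\<^sub>m smul\<^sub>p ip\<^sub>p G\<^sub>m G\<^sub>p"
    and B: "operator_on smul B" "extends_op B A\<^sub>0"
  shows "generates_contraction_semigroup smul B \<longleftrightarrow>
    (\<exists>\<Phi>. linear_contraction smul\<^sub>m smul\<^sub>p \<Phi> \<and>
      op_dom B = {w \<in> op_dom A. \<Phi> (G\<^sub>m w) = G\<^sub>p w} \<and>
      (\<forall>w\<in>op_dom B. op_app B w = op_app A w))"
proof -
  interpret H: pre_hilbert smul ip by (rule hilbert)
  have m: "pre_hilbert smul\<^sub>m ip\<^sub>m" and p: "pre_hilbert smul\<^sub>p ip\<^sub>p"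
    and lin: "linear_on smul smul\<^sub>m (op_dom A) G\<^sub>m" "linear_on smul smul\<^sub>p (op_dom A) G\<^sub>p"
    using quadruple unfolding boundary_quadruple_def Let_def A_def[symmetric] by auto
  interpret M: pre_hilbert smul\<^sub>m ip\<^sub>m by (rule m)
  interpret P: pre_hilbert smul\<^sub>p ip\<^sub>p by (rule p)
  interpret Q: boundary_form "re_form ip" "re_form ip\<^sub>m" "re_form ip\<^sub>p" "op_dom A\<^sub>0" "op_dom A"
    "op_app A" G\<^sub>m G\<^sub>p
    by (rule boundary_form_of_quadruple[OF hilbert A0 A_def quadruple])
  have B_sub: "subspace (op_dom B)"
    using B(1) H.real_subspace by (simp add: operator_on_def)
  have B_lin: "linear_on scaleR scaleR (op_dom B) (op_app B)"
    using B(1) linear_on_real[OF hilbert hilbert] by (simp add: operator_on_def)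
  have A0_B: "op_dom A\<^sub>0 \<subseteq> op_dom B" using B(2) by (simp add: extends_op_def)
  have ext: "op_app B u = op_app A u" if "u \<in> op_dom A\<^sub>0" for u
  proof -
    have "op_app A u = op_app A\<^sub>0 u"
      unfolding A_def
      using H.neg_adjoint_iff[OF A0(1,2), of u "op_app A\<^sub>0 u"] A0(3) that
      unfolding H.adjoint_relation_re[OF A0(1)] skew_symmetric_def by blast
    then show ?thesis using B(2) that by (simp add: extends_op_def)
  qed
  show ?thesis
  proof
    assume "generates_contraction_semigroup smul B"
    then obtain T where T: "contraction_semigroup smul T" "generator_of B T"
      unfolding generates_contraction_semigroup_def contraction_semigroup_def by blast
    have diss: "re_form ip (op_app B u) u \<le> 0" if "u \<in> op_dom B" for u
      by (rule contraction_semigroup.generator_dissipative[OF T(1) H.inner_form T(2) that])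
    have BA: "u \<in> op_dom A" "op_app A u = op_app B u" if "u \<in> op_dom B" for u
      using Q.dissipative_extension_restricts[OF B_sub A0_B B_lin ext diss that] by auto
    have sub: "op_dom B \<subseteq> op_dom A" using BA by blast
    have diss_A: "re_form ip (op_app A u) u \<le> 0" if "u \<in> op_dom B" for u
      using diss[OF that] BA[OF that] by simp
    have range: "\<exists>u\<in>op_dom B. u - op_app A u = f" for f
      using contraction_semigroup.generator_range[OF T, of f] BA by auto
    obtain \<Phi> where \<Phi>: "\<And>u. u \<in> op_dom B \<Longrightarrow> \<Phi> (G\<^sub>m u) = G\<^sub>p u" "\<And>x. norm (\<Phi> x) \<le> norm x"
        "op_dom B = Q.graph_dom \<Phi>"
      using Q.maximal_dissipative_graph[OF B_sub sub diss_A range] by blast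
    have onto: "\<exists>u\<in>op_dom B. G\<^sub>m u = x" for x
      using Q.maximal_dissipative_trace_onto[OF B_sub sub diss_A range] by blast
    \<comment> \<open>Every vector of the minus space is the trace of some \<open>u\<close> in
      \<open>op_dom B\<close>, a subspace over the full scalar field, so \<Phi> inherits linearity
      from the two traces.\<close>
    have "Vector_Spaces.linear smul\<^sub>m smul\<^sub>p \<Phi>"
      unfolding Vector_Spaces.linear_iff
    proof (intro conjI allI)
      fix x y c
      obtain u v where u: "u \<in> op_dom B" "G\<^sub>m u = x" and v: "v \<in> op_dom B" "G\<^sub>m v = y"
        using onto by metis
      have "u + v \<in> op_dom B" using u v B_sub by (simp add: subspace_add)
      then show "\<Phi> (x + y) = \<Phi> x + \<Phi> y"
        using \<Phi>(1)[of "u + v"] \<Phi>(1)[of u] \<Phi>(1)[of v] u v lin BA by (simp add: linear_on_def)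
      have "smul c u \<in> op_dom B" using u B(1) by (simp add: operator_on_def H.subspace_scale)
      then show "\<Phi> (smul\<^sub>m c x) = smul\<^sub>p c (\<Phi> x)"
        using \<Phi>(1)[of "smul c u"] \<Phi>(1)[of u] u lin BA by (simp add: linear_on_def)
    qed (rule M.vector_space_axioms P.vector_space_axioms)+
    then have "linear_contraction smul\<^sub>m smul\<^sub>p \<Phi>"
      using \<Phi>(2) by (simp add: linear_contraction_def)
    moreover have "op_dom B = {w \<in> op_dom A. \<Phi> (G\<^sub>m w) = G\<^sub>p w}"
      using \<Phi>(3) by (simp add: Q.graph_dom_def)
    moreover have "\<forall>w\<in>op_dom B. op_app B w = op_app A w" using BA by simp
    ultimately show "\<exists>\<Phi>. linear_contraction smul\<^sub>m smul\<^sub>p \<Phi> \<and>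
        op_dom B = {w \<in> op_dom A. \<Phi> (G\<^sub>m w) = G\<^sub>p w} \<and> (\<forall>w\<in>op_dom B. op_app B w = op_app A w)"
      by blast
  next
    assume "\<exists>\<Phi>. linear_contraction smul\<^sub>m smul\<^sub>p \<Phi> \<and>
        op_dom B = {w \<in> op_dom A. \<Phi> (G\<^sub>m w) = G\<^sub>p w} \<and> (\<forall>w\<in>op_dom B. op_app B w = op_app A w)"
    then obtain \<Phi> where \<Phi>: "Vector_Spaces.linear smul\<^sub>m smul\<^sub>p \<Phi>" "\<And>x. norm (\<Phi> x) \<le> norm x"
      and dom: "op_dom B = Q.graph_dom \<Phi>" and BA: "\<And>w. w \<in> op_dom B \<Longrightarrow> op_app B w = op_app A w"
      unfolding linear_contraction_def Q.graph_dom_def by blast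
    have \<Phi>_linear: "linear \<Phi>"
    proof (rule linearI)
      show "\<Phi> (x + y) = \<Phi> x + \<Phi> y" for x y
        using \<Phi>(1) by (simp add: Vector_Spaces.linear_iff)
      show "\<Phi> (c *\<^sub>R x) = c *\<^sub>R \<Phi> x" for c x
        using \<Phi>(1) by (simp add: Vector_Spaces.linear_iff flip: M.scale_of_real P.scale_of_real)
    qed
    interpret B: m_dissipative "op_dom B" "op_app B"
    proof
      have "closure (op_dom A\<^sub>0) \<subseteq> closure (op_dom B)" using A0_B by (rule closure_mono)
      then show "closure (op_dom B) = UNIV" using A0(2) by (auto simp: densely_defined_def)
      show "norm u \<le> norm (u - h *\<^sub>R op_app B u)" if "h > 0" "u \<in> op_dom B" for h u
        using Q.V.dissipative_norm_le[OF Q.graph_dom_dissipative[OF \<Phi>(2)]] that BA dom by simp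
      show "\<exists>u\<in>op_dom B. u - h *\<^sub>R op_app B u = f" if "h > 0" for h f
        using Q.graph_dom_range[OF \<Phi>_linear \<Phi>(2) that, of f] BA dom by auto
    qed (rule B_sub B_lin)+
    show "generates_contraction_semigroup smul B"
      using B.generates_contraction_semigroup[OF hilbert] B(1) by simp
  qed
qed

end
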